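(* Let $(M,\mathcal{T})$ be a closed connected triangulated surface with $\mathcal{T}=(V,E,F)$. (1) (PL case) Let $\widetilde{l}:E\to(0,+\infty)$ be a PL metric on $(M,\mathcal{T})$, and let $u,u':V\to\mathbb{R}$ be two functions such that $l_{ij}=\widetilde{l}_{ij}e^{\frac{u_i+u_j}{2}}$ and $l'_{ij}=\widetilde{l}_{ij}e^{\frac{u'_i+u'_j}{2}}$ (for all $v_iv_j\in E$) both define PL metrics on $(M,\mathcal{T})$. If the combinatorial curvatures of $l$ and $l'$ agree at every vertex, then there is $t\in\mathbb{R}$ with $u'=u+t(1,1,\dots,1)$. (2) (PH case) Let $\widetilde{l}:E\to(0,+\infty)$ be a PH metric on $(M,\mathcal{T})$, and let $u,u':V\to\mathbb{R}$ be two functions such that the functions $l,l':E\to(0,+\infty)$ determined by $\sinh\frac{l_{ij}}{2}=\sinh\frac{\widetilde{l}_{ij}}{2}\,e^{\frac{u_i+u_j}{2}}$ and $\sinh\frac{l'_{ij}}{2}=\sinh\frac{\widetilde{l}_{ij}}{2}\,e^{\frac{u'_i+u'_j}{2}}$ (for all $v_iv_j\in E$) are both PH metrics on $(M,\mathcal{T})$. If the combinatorial curvatures of $l$ and $l'$ agree at every vertex, then $u=u'$.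
   Context: $V,E,F$ denote the sets of vertices, edges and faces of a triangulation $\mathcal{T}$ of the closed surface $M$; write $u_i=u(v_i)$ and $l_{ij}=l(v_iv_j)$. A discrete metric is a map $l:E\to(0,+\infty)$ such that for every triangle $\triangle v_iv_jv_k\in F$ the numbers $l_{ij},l_{ik},l_{jk}$ satisfy the strict triangle inequalities. Replacing each face by the Euclidean (respectively hyperbolic, i.e. in $\mathbb{H}^2$) triangle with these edge lengths and gluing isometrically along edges gives a piecewise linear (PL) (respectively piecewise hyperbolic (PH)) metric on $(M,\mathcal{T})$; the map $l$ itself is then called a PL (respectively PH) metric. The combinatorial curvature at the vertex $v_i$ is $K_i=2\pi-$ (the sum of the inner angles at $v_i$ of the triangles of $F$ incident to $v_i$), the angles being those of the Euclidean triangles in the PL case and of the hyperbolic triangles in the PH case. A function $u:V\to\mathbb{R}$ relating $\widetilde{l}$ and $l$ as in the claim is called a discrete conformal factor. *)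

theory Defs
  imports "HOL-Analysis.Analysis"
begin

section \<open>Triangulated closed surfaces\<close>

definition closed_surface :: "'m topology \<Rightarrow> bool" where
  "closed_surface M \<longleftrightarrow>
     compact_space M \<and> Hausdorff_space M \<and> second_countable M \<and>
     (\<forall>x \<in> topspace M. \<exists>U W. openin M U \<and> x \<in> U \<and> open W \<and>
        subtopology M U homeomorphic_space top_of_set (W :: (real ^ 2) set))"

definition vertices :: "'a::euclidean_space set set \<Rightarrow> 'a set" where
  "vertices \<T> = {v. {v} \<in> \<T>}"

definition edges :: "'a::euclidean_space set set \<Rightarrow> 'a set set" where
  "edges \<T> = {e \<in> \<T>. 1 simplex e}"

definition faces :: "'a::euclidean_space set set \<Rightarrow> 'a set set" where
  "faces \<T> = {f \<in> \<T>. 2 simplex f}"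

text \<open>
  The library's simplicial complexes are geometric: finite sets of simplices in a Euclidean
  space of arbitrary dimension. The condition that every simplex is contained in a triangle
  says that the complex consists of \<open>V\<close>, \<open>E\<close>, \<open>F\<close> (and the empty simplex) only and that it is
  obtained by gluing its triangles.
\<close>

definition triangulates :: "'a::euclidean_space set set \<Rightarrow> 'm topology \<Rightarrow> bool" where
  "triangulates \<T> M \<longleftrightarrow>
     simplicial_complex \<T> \<and> (\<forall>s \<in> \<T>. \<exists>f \<in> faces \<T>. s \<subseteq> f) \<and>
     top_of_set (\<Union>\<T>) homeomorphic_space M"

section \<open>Discrete metrics\<close>

abbreviation edge :: "'a::euclidean_space \<Rightarrow> 'a \<Rightarrow> 'a set" where
  "edge v w \<equiv> convex hull {v, w}"

text \<open>
  A map \<open>E \<rightarrow> (0, \<infinity>)\<close> is a function on sets of which only the values on \<open>edges \<T>\<close> matter.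
  In the second conjunct \<open>i\<close>, \<open>j\<close>, \<open>k\<close> range over all orderings of the vertices of a triangle,
  so that all three triangle inequalities are covered.
  PL and PH metrics are the same maps \<open>l\<close>; they differ in the geometry of the triangles that are
  glued, hence in the angles below.
\<close>

definition discrete_metric :: "'a::euclidean_space set set \<Rightarrow> ('a set \<Rightarrow> real) \<Rightarrow> bool" where
  "discrete_metric \<T> l \<longleftrightarrow>
     (\<forall>e \<in> edges \<T>. 0 < l e) \<and>
     (\<forall>i j k. convex hull {i, j, k} \<in> faces \<T> \<longrightarrow>
        l (edge i j) < l (edge i k) + l (edge j k))"

section \<open>Inner angles\<close>

definition euclidean_vertex_angle :: "real ^ 2 \<Rightarrow> real ^ 2 \<Rightarrow> real ^ 2 \<Rightarrow> real" where
  "euclidean_vertex_angle P Q R =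
     arccos ((Q - P) \<bullet> (R - P) / (norm (Q - P) * norm (R - P)))"

text \<open>
  \<open>euclidean_angle a b c\<close> is the inner angle between the sides of lengths \<open>a\<close> and \<open>b\<close> of a Euclidean
  triangle whose third side has length \<open>c\<close>.
\<close>

definition euclidean_angle :: "real \<Rightarrow> real \<Rightarrow> real \<Rightarrow> real" where
  "euclidean_angle a b c =
     (THE \<theta>. \<exists>P Q R. dist P Q = a \<and> dist P R = b \<and> dist Q R = c \<and>
        \<theta> = euclidean_vertex_angle P Q R)"

text \<open>
  The hyperbolic plane is the upper sheet of the hyperboloid in Minkowski space. The projection of
  \<open>Q\<close> to the tangent space at \<open>P\<close>, namely \<open>Q + \<langle>P, Q\<rangle> P\<close>, points in the direction in which
  the geodesic from \<open>P\<close> to \<open>Q\<close> leaves \<open>P\<close>, and the Minkowski form is positive definite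
  on that tangent space.
\<close>

type_synonym minkowski = "real \<times> real \<times> real"

fun mink :: "minkowski \<Rightarrow> minkowski \<Rightarrow> real" where
  "mink (x, y, z) (x', y', z') = x * x' + y * y' - z * z'"

definition hyperbolic_plane :: "minkowski set" where
  "hyperbolic_plane = {P. mink P P = -1 \<and> 0 < snd (snd P)}"

definition hyperbolic_dist :: "minkowski \<Rightarrow> minkowski \<Rightarrow> real" where
  "hyperbolic_dist P Q = arcosh (- mink P Q)"

definition geodesic_direction :: "minkowski \<Rightarrow> minkowski \<Rightarrow> minkowski" where
  "geodesic_direction P Q = Q + mink P Q *\<^sub>R P"

definition hyperbolic_vertex_angle :: "minkowski \<Rightarrow> minkowski \<Rightarrow> minkowski \<Rightarrow> real" where
  "hyperbolic_vertex_angle P Q R =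
     (let X = geodesic_direction P Q; Y = geodesic_direction P R
      in arccos (mink X Y / (sqrt (mink X X) * sqrt (mink Y Y))))"

definition hyperbolic_angle :: "real \<Rightarrow> real \<Rightarrow> real \<Rightarrow> real" where
  "hyperbolic_angle a b c =
     (THE \<theta>. \<exists>P \<in> hyperbolic_plane. \<exists>Q \<in> hyperbolic_plane. \<exists>R \<in> hyperbolic_plane.
        hyperbolic_dist P Q = a \<and> hyperbolic_dist P R = b \<and> hyperbolic_dist Q R = c \<and>
        \<theta> = hyperbolic_vertex_angle P Q R)"

section \<open>Combinatorial curvature\<close>

text \<open>
  The parameter \<open>ang\<close> is \<open>euclidean_angle\<close> or \<open>hyperbolic_angle\<close>. As \<open>f\<close> is a triangle of which \<open>i\<close>
  is a vertex, \<open>j\<close> and \<open>k\<close> are its two other vertices, and their order does not matter.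
\<close>

definition face_angle ::
    "(real \<Rightarrow> real \<Rightarrow> real \<Rightarrow> real) \<Rightarrow> ('a::euclidean_space set \<Rightarrow> real) \<Rightarrow> 'a set \<Rightarrow> 'a \<Rightarrow> real" where
  "face_angle ang l f i =
     (THE \<theta>. \<exists>j k. f = convex hull {i, j, k} \<and>
        \<theta> = ang (l (edge i j)) (l (edge i k)) (l (edge j k)))"

definition curvature ::
    "(real \<Rightarrow> real \<Rightarrow> real \<Rightarrow> real) \<Rightarrow> 'a::euclidean_space set set \<Rightarrow> ('a set \<Rightarrow> real) \<Rightarrow> 'a \<Rightarrow> real" where
  "curvature ang \<T> l i = 2 * pi - (\<Sum>f \<in> {f \<in> faces \<T>. i \<in> f}. face_angle ang l f i)"

abbreviation PL_curvature :: "'a::euclidean_space set set \<Rightarrow> ('a set \<Rightarrow> real) \<Rightarrow> 'a \<Rightarrow> real" where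
  "PL_curvature \<equiv> curvature euclidean_angle"

abbreviation PH_curvature :: "'a::euclidean_space set set \<Rightarrow> ('a set \<Rightarrow> real) \<Rightarrow> 'a \<Rightarrow> real" where
  "PH_curvature \<equiv> curvature hyperbolic_angle"

section \<open>Discrete conformal factors\<close>

definition PL_conformal_factor ::
    "'a::euclidean_space set set \<Rightarrow> ('a set \<Rightarrow> real) \<Rightarrow> ('a \<Rightarrow> real) \<Rightarrow> ('a set \<Rightarrow> real) \<Rightarrow> bool" where
  "PL_conformal_factor \<T> l0 u l \<longleftrightarrow>
     (\<forall>i j. edge i j \<in> edges \<T> \<longrightarrow> l (edge i j) = l0 (edge i j) * exp ((u i + u j) / 2))"

definition PH_conformal_factor ::
    "'a::euclidean_space set set \<Rightarrow> ('a set \<Rightarrow> real) \<Rightarrow> ('a \<Rightarrow> real) \<Rightarrow> ('a set \<Rightarrow> real) \<Rightarrow> bool" where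
  "PH_conformal_factor \<T> l0 u l \<longleftrightarrow>
     (\<forall>i j. edge i j \<in> edges \<T> \<longrightarrow>
        sinh (l (edge i j) / 2) = sinh (l0 (edge i j) / 2) * exp ((u i + u j) / 2))"

end

theory Submission
  imports Defs
begin

text \<open>
  The conformal class of a triangle is a family of side lengths in which the admissible conformal
  factors do not form a convex set, but the admissible angles do: they form an open simplex. The
  Legendre dual form of the variational principle therefore avoids extending the angles to
  degenerate triangles. On triples of positive angles with sum \<open>\<pi>\<close>, the map
  \<open>\<theta> \<mapsto> (ln (sin \<theta>\<^sub>1), ln (sin \<theta>\<^sub>2), ln (sin \<theta>\<^sub>3))\<close> is strictly monotone, because its derivative along a
  vector \<open>x\<close> with \<open>\<Sum> x\<^sub>i = 0\<close> pairs with \<open>x\<close> to \<open>\<Sum> x\<^sub>i\<^sup>2 cot \<theta>\<^sub>i\<close>, which is positive since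
  \<open>cot \<theta>\<^sub>1 cot \<theta>\<^sub>2 + cot \<theta>\<^sub>2 cot \<theta>\<^sub>3 + cot \<theta>\<^sub>3 cot \<theta>\<^sub>1 = 1\<close>. By the law of sines this says that
  \<open>\<Sum> (u'\<^sub>i - u\<^sub>i) (\<theta>'\<^sub>i - \<theta>\<^sub>i) \<le> 0\<close> in a Euclidean triangle, with equality only if the angles agree. In a
  hyperbolic triangle with angle defect \<open>2 \<sigma>\<close> the same sum is a negative combination of six such
  Euclidean terms, for the triples \<open>(\<alpha>, \<sigma> + \<beta>, \<sigma> + \<gamma>)\<close> and \<open>(\<sigma>, \<alpha>, \<pi> - \<sigma> - \<alpha>)\<close> and their
  permutations. Summed over all faces the left-hand side is \<open>- \<Sum> (u'\<^sub>i - u\<^sub>i) (K'\<^sub>i - K\<^sub>i) = 0\<close>, so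
  equality holds in every face.
\<close>

section \<open>Monotonicity of the logarithmic sine on angle triples\<close>

text \<open>A cotangent can be negative, so the terms are not positive one by one. With
  \<open>c = - a - b\<close> the sum is a binary quadratic form in \<open>a\<close> and
  \<open>b\<close>. Its leading coefficient \<open>cot \<alpha> + cot \<gamma>\<close> is positive
  and its determinant is the cotangent sum \<open>prod\<close>, which equals 1; completing the
  square finishes.\<close>

lemma cot_form_pos:
  fixes a b c :: real
  assumes "0 < \<alpha>" "0 < \<beta>" "0 < \<gamma>" "\<alpha> + \<beta> + \<gamma> = pi" "a + b + c = 0" "a \<noteq> 0 \<or> b \<noteq> 0"
  shows "0 < a\<^sup>2 * cot \<alpha> + b\<^sup>2 * cot \<beta> + c\<^sup>2 * cot \<gamma>"
proof -
  have sin: "sin \<alpha> > 0" "sin \<beta> > 0" "sin \<gamma> > 0"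
    using assms by (auto intro!: sin_gt_zero)
  have \<gamma>: "\<gamma> = pi - (\<alpha> + \<beta>)" and \<beta>: "\<beta> = pi - (\<alpha> + \<gamma>)"
    using assms by simp_all
  have prod: "cot \<alpha> * cot \<beta> + cot \<beta> * cot \<gamma> + cot \<gamma> * cot \<alpha> = 1"
  proof -
    have s: "sin \<gamma> = sin (\<alpha> + \<beta>)" and c: "cos \<gamma> = - cos (\<alpha> + \<beta>)"
      unfolding \<gamma> by simp_all
    have "cos \<alpha> * cos \<beta> * sin \<gamma> + (sin \<alpha> * cos \<beta> + cos \<alpha> * sin \<beta>) * cos \<gamma>
        = sin \<alpha> * sin \<beta> * sin \<gamma>"
      by (simp add: s c sin_add cos_add algebra_simps)
    then show ?thesis
      using sin by (simp add: cot_def field_simps)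
  qed
  have pos: "0 < cot \<alpha> + cot \<gamma>"
  proof -
    have "cot \<alpha> + cot \<gamma> = sin (\<alpha> + \<gamma>) / (sin \<alpha> * sin \<gamma>)"
      using sin by (simp add: cot_def sin_add field_simps)
    also have "sin (\<alpha> + \<gamma>) = sin \<beta>"
      unfolding \<beta> by simp
    finally show ?thesis
      using sin by simp
  qed
  have c: "c = - a - b"
    using assms by simp
  have "(cot \<alpha> + cot \<gamma>) * (a\<^sup>2 * cot \<alpha> + b\<^sup>2 * cot \<beta> + c\<^sup>2 * cot \<gamma>)
      = ((cot \<alpha> + cot \<gamma>) * a + cot \<gamma> * b)\<^sup>2 + b\<^sup>2 * (cot \<alpha> * cot \<beta> + cot \<beta> * cot \<gamma> + cot \<gamma> * cot \<alpha>)"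
    unfolding c by algebra
  also have "\<dots> = ((cot \<alpha> + cot \<gamma>) * a + cot \<gamma> * b)\<^sup>2 + b\<^sup>2"
    by (simp add: prod)
  also have "\<dots> > 0"
    using assms(6) pos by (cases "b = 0") (auto intro: add_nonneg_pos)
  finally show ?thesis
    using pos by (simp add: zero_less_mult_iff)
qed

text \<open>Positive triples with sum \<open>pi\<close> form a convex set, so the segment between
  the two triples stays inside it. The mean value theorem along the segment reduces the claim to
  \<open>cot_form_pos\<close>.\<close>

lemma ln_sin_strict_monotone:
  fixes \<alpha> \<beta> \<gamma> \<alpha>' \<beta>' \<gamma>' :: real
  assumes pos: "0 < \<alpha>" "0 < \<beta>" "0 < \<gamma>" "\<alpha> + \<beta> + \<gamma> = pi"
    and pos': "0 < \<alpha>'" "0 < \<beta>'" "0 < \<gamma>'" "\<alpha>' + \<beta>' + \<gamma>' = pi"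
    and ne: "\<alpha>' \<noteq> \<alpha> \<or> \<beta>' \<noteq> \<beta>"
  shows "0 < (\<alpha>' - \<alpha>) * (ln (sin \<alpha>') - ln (sin \<alpha>)) + (\<beta>' - \<beta>) * (ln (sin \<beta>') - ln (sin \<beta>))
           + (\<gamma>' - \<gamma>) * (ln (sin \<gamma>') - ln (sin \<gamma>))"
proof -
  define x y z where "x = \<alpha>' - \<alpha>" and "y = \<beta>' - \<beta>" and "z = \<gamma>' - \<gamma>"
  \<comment> \<open>\<open>g t\<close> pairs the fixed displacement \<open>(x, y, z)\<close> with
    the logarithmic sines at time \<open>t\<close>, so \<open>g 1 - g 0\<close> is the expression in
    the claim and \<open>g'\<close> is the cotangent form.\<close>
  define g where "g t = x * ln (sin (\<alpha> + t * x)) + y * ln (sin (\<beta> + t * y)) + z * ln (sin (\<gamma> + t * z))" for t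
  define g' where "g' t = x\<^sup>2 * cot (\<alpha> + t * x) + y\<^sup>2 * cot (\<beta> + t * y) + z\<^sup>2 * cot (\<gamma> + t * z)" for t
  have between: "0 < p + t * (p' - p)" if "0 < p" "0 < p'" "0 \<le> t" "t \<le> 1" for p p' t :: real
  proof -
    have "p + t * (p' - p) = (1 - t) * p + t * p'"
      by (simp add: algebra_simps)
    also have "\<dots> > 0"
      using that by (cases "t = 0") (auto intro: add_nonneg_pos)
    finally show ?thesis .
  qed
  have sum: "(\<alpha> + t * x) + (\<beta> + t * y) + (\<gamma> + t * z) = pi" for t
  proof -
    have "x + y + z = 0"
      using pos(4) pos'(4) by (simp add: x_def y_def z_def)
    then have "t * x + t * y + t * z = 0"
      by (metis distrib_left mult_zero_right)
    with pos(4) show ?thesis by simp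
  qed
  have angles: "0 < \<alpha> + t * x" "0 < \<beta> + t * y" "0 < \<gamma> + t * z" if "0 \<le> t" "t \<le> 1" for t
    unfolding x_def y_def z_def using that pos pos' by (auto intro!: between)
  have deriv: "(g has_real_derivative g' t) (at t)" if "0 \<le> t" "t \<le> 1" for t
  proof -
    have "sin (\<alpha> + t * x) > 0" "sin (\<beta> + t * y) > 0" "sin (\<gamma> + t * z) > 0"
      using angles[OF that] sum[of t] by (auto intro!: sin_gt_zero)
    then show ?thesis
      unfolding g_def g'_def
      by (auto intro!: derivative_eq_intros simp: cot_def power2_eq_square mult_ac)
  qed
  obtain t where t: "0 < t" "t < 1" "g 1 - g 0 = (1 - 0) * g' t"
    using MVT2[of 0 1 g g'] deriv by auto
  have "0 < g' t"
    unfolding g'_def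
  proof (rule cot_form_pos)
    show "x + y + z = 0" "x \<noteq> 0 \<or> y \<noteq> 0"
      using pos(4) pos'(4) ne by (auto simp: x_def y_def z_def)
  qed (use angles[of t] sum t in auto)
  with t(3) show ?thesis
    by (simp add: g_def x_def y_def z_def algebra_simps)
qed

lemma ln_sin_monotone:
  fixes \<alpha> \<beta> \<gamma> \<alpha>' \<beta>' \<gamma>' :: real
  assumes "0 < \<alpha>" "0 < \<beta>" "0 < \<gamma>" "\<alpha> + \<beta> + \<gamma> = pi"
    and "0 < \<alpha>'" "0 < \<beta>'" "0 < \<gamma>'" "\<alpha>' + \<beta>' + \<gamma>' = pi"
  shows "0 \<le> (\<alpha>' - \<alpha>) * (ln (sin \<alpha>') - ln (sin \<alpha>)) + (\<beta>' - \<beta>) * (ln (sin \<beta>') - ln (sin \<beta>))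
           + (\<gamma>' - \<gamma>) * (ln (sin \<gamma>') - ln (sin \<gamma>))"
proof (cases "\<alpha>' \<noteq> \<alpha> \<or> \<beta>' \<noteq> \<beta>")
  case True
  then show ?thesis using ln_sin_strict_monotone[OF assms] by simp
next
  case False
  then have "\<gamma>' = \<gamma>" using assms by linarith
  with False show ?thesis by simp
qed

section \<open>Euclidean triangles\<close>

lemma triangle_ineq_pos:
  fixes a b c :: real
  assumes "a < b + c" "b < a + c" "c < a + b"
  shows "0 < a" "0 < b" "0 < c"
  using assms by linarith+

text \<open>Polarization: the law of cosines before division by the side lengths.\<close>

lemma inner_from_dist:
  fixes P Q R :: "'v::real_inner"
  shows "(Q - P) \<bullet> (R - P) = ((dist P Q)\<^sup>2 + (dist P R)\<^sup>2 - (dist Q R)\<^sup>2) / 2"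
proof -
  have "Q - R = (Q - P) - (R - P)" by simp
  then show ?thesis
    by (simp only: dist_norm norm_minus_commute[of P])
       (simp add: power2_norm_eq_inner inner_diff inner_commute algebra_simps)
qed

text \<open>The bounds are \<open>c\<^sup>2 < (a + b)\<^sup>2\<close> and
  \<open>(a - b)\<^sup>2 < c\<^sup>2\<close> in factored form. Their strictness keeps the angles
  away from 0 and \<open>pi\<close>.\<close>

lemma cos_quotient_bounds:
  fixes a b c :: real
  assumes "a < b + c" "b < a + c" "c < a + b"
  shows "-1 < (a\<^sup>2 + b\<^sup>2 - c\<^sup>2) / (2 * a * b)" "(a\<^sup>2 + b\<^sup>2 - c\<^sup>2) / (2 * a * b) < 1"
proof -
  note pos = triangle_ineq_pos[OF assms]
  have "0 < (a + b - c) * (a + b + c)" "0 < (c - a + b) * (c + a - b)"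
    using assms pos by auto
  then show "-1 < (a\<^sup>2 + b\<^sup>2 - c\<^sup>2) / (2 * a * b)" "(a\<^sup>2 + b\<^sup>2 - c\<^sup>2) / (2 * a * b) < 1"
    using pos by (simp_all add: field_simps power2_eq_square)
qed

text \<open>The definite description denotes something only if the triangle exists and its angle is
  unique. Uniqueness is the law of cosines; existence is an explicit triangle.\<close>

lemma euclidean_angle_eq:
  assumes "a < b + c" "b < a + c" "c < a + b"
  shows "euclidean_angle a b c = arccos ((a\<^sup>2 + b\<^sup>2 - c\<^sup>2) / (2 * a * b))"
  unfolding euclidean_angle_def
proof (rule the_equality)
  note pos = triangle_ineq_pos[OF assms]
  define q where "q = (a\<^sup>2 + b\<^sup>2 - c\<^sup>2) / (2 * a * b)"
  have eq: "euclidean_vertex_angle P Q R = arccos q"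
    if "dist P Q = a" "dist P R = b" "dist Q R = c" for P Q R
    using that
    by (simp add: euclidean_vertex_angle_def inner_from_dist q_def dist_commute mult.assoc flip: dist_norm)
  then show "\<theta> = arccos ((a\<^sup>2 + b\<^sup>2 - c\<^sup>2) / (2 * a * b))"
    if "\<exists>P Q R. dist P Q = a \<and> dist P R = b \<and> dist Q R = c \<and> \<theta> = euclidean_vertex_angle P Q R" for \<theta>
    using that unfolding q_def by blast
  have q: "-1 < q" "q < 1"
    using cos_quotient_bounds[OF assms] by (simp_all add: q_def)
  then have q2: "1 - q\<^sup>2 \<ge> 0"
    by (simp add: abs_square_le_1)
  \<comment> \<open>The first vertex is the origin, \<open>Q\<close> lies on the first axis, and
    \<open>R\<close> has polar coordinates \<open>b\<close> and \<open>arccos q\<close>.\<close>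
  define Q :: "real^2" where "Q = vector [a, 0]"
  define R :: "real^2" where "R = vector [b * q, b * sqrt (1 - q\<^sup>2)]"
  have inner: "x \<bullet> y = x $ 1 * y $ 1 + x $ 2 * y $ 2" for x y :: "real^2"
    by (simp add: inner_vec_def sum_2)
  have "dist 0 Q = a"
    using pos by (simp add: Q_def norm_eq_sqrt_inner inner)
  moreover have "R \<bullet> R = b\<^sup>2"
    using q2 by (simp add: R_def inner power2_eq_square algebra_simps)
  then have "dist 0 R = b"
    using pos by (simp add: norm_eq_sqrt_inner)
  moreover have "(Q - R) \<bullet> (Q - R) = a\<^sup>2 + b\<^sup>2 - 2 * a * b * q"
    using q2 by (simp add: Q_def R_def inner power2_eq_square algebra_simps)
  then have "(Q - R) \<bullet> (Q - R) = c\<^sup>2"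
    using pos by (simp add: q_def)
  then have "dist Q R = c"
    using pos by (simp add: dist_norm norm_eq_sqrt_inner)
  ultimately show "\<exists>P Q R. dist P Q = a \<and> dist P R = b \<and> dist Q R = c
      \<and> arccos ((a\<^sup>2 + b\<^sup>2 - c\<^sup>2) / (2 * a * b)) = euclidean_vertex_angle P Q R"
    using eq unfolding q_def by metis
qed

lemma euclidean_angle_commute:
  assumes "a < b + c" "b < a + c" "c < a + b"
  shows "euclidean_angle b a c = euclidean_angle a b c"
  using assms by (simp add: euclidean_angle_eq add.commute mult.commute mult.left_commute)

text \<open>Law of sines and angle sum together. The factor \<open>r\<close> is the diameter of the
  circumscribed circle.\<close>

lemma euclidean_triangle:
  fixes a b c :: real
  assumes "a < b + c" "b < a + c" "c < a + b"
  obtains r where "0 < r" "a = r * sin (euclidean_angle b c a)" "b = r * sin (euclidean_angle a c b)"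
    "c = r * sin (euclidean_angle a b c)"
    "0 < euclidean_angle b c a" "0 < euclidean_angle a c b" "0 < euclidean_angle a b c"
    "euclidean_angle b c a + euclidean_angle a c b + euclidean_angle a b c = pi"
proof -
  note pos = triangle_ineq_pos[OF assms]
  define \<alpha> \<beta> \<gamma> where "\<alpha> = euclidean_angle b c a" and "\<beta> = euclidean_angle a c b"
    and "\<gamma> = euclidean_angle a b c"
  \<comment> \<open>Heron's product, 16 times the squared area. It is symmetric in the sides, so the
    sines of all three angles share the numerator \<open>sqrt D\<close>.\<close>
  define D where "D = (a + b + c) * (b + c - a) * (a + c - b) * (a + b - c)"
  have "D > 0"
    using assms pos by (simp add: D_def)
  have ang: "0 < euclidean_angle a b c" "euclidean_angle a b c < pi"
      "cos (euclidean_angle a b c) = (a\<^sup>2 + b\<^sup>2 - c\<^sup>2) / (2 * a * b)"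
      "sin (euclidean_angle a b c) = sqrt ((a + b + c) * (b + c - a) * (a + c - b) * (a + b - c)) / (2 * a * b)"
    if "a < b + c" "b < a + c" "c < a + b" for a b c
  proof -
    note pos = triangle_ineq_pos[OF that]
    note bounds = cos_quotient_bounds[OF that] and eq = euclidean_angle_eq[OF that]
    show "0 < euclidean_angle a b c" "euclidean_angle a b c < pi"
      using bounds arccos_lt_bounded unfolding eq by blast+
    show "cos (euclidean_angle a b c) = (a\<^sup>2 + b\<^sup>2 - c\<^sup>2) / (2 * a * b)"
      using bounds unfolding eq by (intro cos_arccos) auto
    have "sin (euclidean_angle a b c) = sqrt (1 - ((a\<^sup>2 + b\<^sup>2 - c\<^sup>2) / (2 * a * b))\<^sup>2)"
      using bounds unfolding eq by (intro sin_arccos) auto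
    also have "1 - ((a\<^sup>2 + b\<^sup>2 - c\<^sup>2) / (2 * a * b))\<^sup>2
        = ((a + b + c) * (b + c - a) * (a + c - b) * (a + b - c)) / (2 * a * b)\<^sup>2"
      using pos by (simp add: field_simps) algebra
    also have "sqrt \<dots> = sqrt ((a + b + c) * (b + c - a) * (a + c - b) * (a + b - c)) / (2 * a * b)"
      using pos by (simp add: real_sqrt_divide)
    finally show "sin (euclidean_angle a b c)
        = sqrt ((a + b + c) * (b + c - a) * (a + c - b) * (a + b - c)) / (2 * a * b)" .
  qed
  have perm: "(b + c + a) * (c + a - b) * (b + a - c) * (b + c - a) = D"
    "(a + c + b) * (c + b - a) * (a + b - c) * (a + c - b) = D"
    by (simp_all add: D_def algebra_simps)
  have \<alpha>: "0 < \<alpha>" "\<alpha> < pi" "cos \<alpha> = (b\<^sup>2 + c\<^sup>2 - a\<^sup>2) / (2 * b * c)" "sin \<alpha> = sqrt D / (2 * b * c)"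
    using ang[of b c a] assms perm by (simp_all add: \<alpha>_def add.commute)
  have \<beta>: "0 < \<beta>" "\<beta> < pi" "cos \<beta> = (a\<^sup>2 + c\<^sup>2 - b\<^sup>2) / (2 * a * c)" "sin \<beta> = sqrt D / (2 * a * c)"
    using ang[of a c b] assms perm by (simp_all add: \<beta>_def add.commute)
  have \<gamma>: "0 < \<gamma>" "\<gamma> < pi" "cos \<gamma> = (a\<^sup>2 + b\<^sup>2 - c\<^sup>2) / (2 * a * b)" "sin \<gamma> = sqrt D / (2 * a * b)"
    using ang[of a b c] assms by (simp_all add: \<gamma>_def D_def)
  have DD: "sqrt D * sqrt D = D"
    using \<open>D > 0\<close> by simp
  \<comment> \<open>The angle sum is read off from the formulas: \<open>\<alpha> + \<beta>\<close>
    and \<open>pi - \<gamma>\<close> have the same sine and cosine. The positive sine puts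
    \<open>\<alpha> + \<beta>\<close> below \<open>pi\<close>, where the cosine is
    injective.\<close>
  have "sin (\<alpha> + \<beta>) = sin \<gamma>"
    using pos unfolding sin_add \<alpha> \<beta> \<gamma> by (simp add: field_simps power2_eq_square)
  have cos_sum: "cos (\<alpha> + \<beta>) = cos (pi - \<gamma>)"
  proof -
    have "(b\<^sup>2 + c\<^sup>2 - a\<^sup>2) * (a\<^sup>2 + c\<^sup>2 - b\<^sup>2) - D = - (2 * c\<^sup>2 * (a\<^sup>2 + b\<^sup>2 - c\<^sup>2))"
      unfolding D_def by algebra
    moreover have "cos (\<alpha> + \<beta>) = ((b\<^sup>2 + c\<^sup>2 - a\<^sup>2) * (a\<^sup>2 + c\<^sup>2 - b\<^sup>2) - sqrt D * sqrt D) / (4 * a * b * c\<^sup>2)"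
    proof -
      have "X / (2 * b * c) * (Y / (2 * a * c)) - Z / (2 * b * c) * (Z / (2 * a * c))
          = (X * Y - Z * Z) / (4 * a * b * c\<^sup>2)" for X Y Z
        by (simp add: diff_divide_distrib power2_eq_square mult_ac)
      then show ?thesis
        unfolding cos_add \<alpha>(3,4) \<beta>(3,4) .
    qed
    ultimately have "cos (\<alpha> + \<beta>) = - (2 * c\<^sup>2 * (a\<^sup>2 + b\<^sup>2 - c\<^sup>2)) / (4 * a * b * c\<^sup>2)"
      unfolding DD by simp
    also have "\<dots> = - ((a\<^sup>2 + b\<^sup>2 - c\<^sup>2) / (2 * a * b))"
      using pos by (simp add: divide_simps)
    finally show ?thesis
      by (simp add: \<gamma>)
  qed
  have "0 < sin (\<alpha> + \<beta>)"
    using sin_gt_zero[OF \<gamma>(1,2)] \<open>sin (\<alpha> + \<beta>) = sin \<gamma>\<close> by simp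
  then have "\<alpha> + \<beta> < pi"
    using \<alpha>(2) \<beta>(2) sin_le_zero[of "\<alpha> + \<beta>"] by linarith
  then have "\<alpha> + \<beta> = pi - \<gamma>"
    using cos_sum \<alpha>(1) \<beta>(1) \<gamma>(1,2) by (rule_tac cos_inj_pi) auto
  then have sum: "\<alpha> + \<beta> + \<gamma> = pi"
    by simp
  show ?thesis
  proof (rule that)
    show "0 < 2 * a * b * c / sqrt D"
      using pos \<open>D > 0\<close> by simp
    show "a = 2 * a * b * c / sqrt D * sin (euclidean_angle b c a)"
      "b = 2 * a * b * c / sqrt D * sin (euclidean_angle a c b)"
      "c = 2 * a * b * c / sqrt D * sin (euclidean_angle a b c)"
      unfolding \<alpha>_def[symmetric] \<beta>_def[symmetric] \<gamma>_def[symmetric] \<alpha> \<beta> \<gamma>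
      using pos \<open>D > 0\<close> by simp_all
  qed (use \<alpha> \<beta> \<gamma> sum in \<open>simp_all add: \<alpha>_def \<beta>_def \<gamma>_def\<close>)
qed

text \<open>Here \<open>x\<close>, \<open>y\<close>, \<open>z\<close> are the changes of the
  conformal factor at the corners opposite to \<open>a\<close>, \<open>b\<close>, \<open>c\<close>.
  The logarithm of the law of sines expresses them through the changes of the logarithmic
  sines.\<close>

lemma euclidean_angle_variation:
  fixes a b c a' b' c' x y z :: real
  assumes tri: "a < b + c" "b < a + c" "c < a + b" and tri': "a' < b' + c'" "b' < a' + c'" "c' < a' + b'"
    and conf: "a' = a * exp ((y + z) / 2)" "b' = b * exp ((x + z) / 2)" "c' = c * exp ((x + y) / 2)"
  defines "S \<equiv> x * (euclidean_angle b' c' a' - euclidean_angle b c a)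
      + y * (euclidean_angle a' c' b' - euclidean_angle a c b)
      + z * (euclidean_angle a' b' c' - euclidean_angle a b c)"
  shows "S \<le> 0" and "S = 0 \<Longrightarrow> x = y \<and> y = z"
proof -
  define \<alpha> \<beta> \<gamma> \<alpha>' \<beta>' \<gamma>' where "\<alpha> = euclidean_angle b c a" and "\<beta> = euclidean_angle a c b"
    and "\<gamma> = euclidean_angle a b c" and "\<alpha>' = euclidean_angle b' c' a'"
    and "\<beta>' = euclidean_angle a' c' b'" and "\<gamma>' = euclidean_angle a' b' c'"
  note defs = this[symmetric]
  obtain r where r: "0 < r" "a = r * sin \<alpha>" "b = r * sin \<beta>" "c = r * sin \<gamma>"
    and ang: "0 < \<alpha>" "0 < \<beta>" "0 < \<gamma>" "\<alpha> + \<beta> + \<gamma> = pi"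
    using euclidean_triangle[OF tri] unfolding defs .
  obtain r' where r': "0 < r'" "a' = r' * sin \<alpha>'" "b' = r' * sin \<beta>'" "c' = r' * sin \<gamma>'"
    and ang': "0 < \<alpha>'" "0 < \<beta>'" "0 < \<gamma>'" "\<alpha>' + \<beta>' + \<gamma>' = pi"
    using euclidean_triangle[OF tri'] unfolding defs .
  have sin: "sin \<alpha> > 0" "sin \<beta> > 0" "sin \<gamma> > 0" "sin \<alpha>' > 0" "sin \<beta>' > 0" "sin \<gamma>' > 0"
    using ang ang' by (auto intro!: sin_gt_zero)
  \<comment> \<open>The change of scale, as the logarithm of the ratio of the
    circumdiameters.\<close>
  define \<rho> where "\<rho> = ln r' - ln r"
  have log_change: "w / 2 = \<rho> + (ln s' - ln s)"
    if "r' * s' = r * s * exp (w / 2)" "s > 0" "s' > 0" for w s s' :: real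
  proof -
    have "ln (r' * s') = ln r' + ln s'" "ln (r * s * exp (w / 2)) = ln r + ln s + w / 2"
      using that(2,3) r(1) r'(1) by (simp_all add: ln_mult)
    then show ?thesis
      using that(1) by (simp add: \<rho>_def)
  qed
  define A B C where "A = ln (sin \<alpha>') - ln (sin \<alpha>)" and "B = ln (sin \<beta>') - ln (sin \<beta>)"
    and "C = ln (sin \<gamma>') - ln (sin \<gamma>)"
  have sums: "y + z = 2 * (\<rho> + A)" "x + z = 2 * (\<rho> + B)" "x + y = 2 * (\<rho> + C)"
    using log_change[of "sin \<alpha>'" "sin \<alpha>" "y + z"] log_change[of "sin \<beta>'" "sin \<beta>" "x + z"]
      log_change[of "sin \<gamma>'" "sin \<gamma>" "x + y"] conf r r' sin
    by (simp_all add: A_def B_def C_def)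
  \<comment> \<open>Thus \<open>x = (\<rho> + A + B + C) - 2 * A\<close>, and likewise for
    \<open>y\<close> and \<open>z\<close>. The bracket is common to all three and pairs to zero with
    the angle changes, whose sum is zero; this leaves \<open>S = - 2 * T\<close>.\<close>
  have xyz: "x = \<rho> + B + C - A" "y = \<rho> + A + C - B" "z = \<rho> + A + B - C"
    by (use sums in argo)+
  define T where "T = (\<alpha>' - \<alpha>) * A + (\<beta>' - \<beta>) * B + (\<gamma>' - \<gamma>) * C"
  have \<gamma>: "\<gamma>' - \<gamma> = - (\<alpha>' - \<alpha>) - (\<beta>' - \<beta>)"
    using ang(4) ang'(4) by linarith
  have S: "S = - 2 * T"
    unfolding S_def T_def defs xyz \<gamma> by algebra
  have "0 \<le> T"
    unfolding T_def A_def B_def C_def using ang ang' by (rule ln_sin_monotone)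
  then show "S \<le> 0"
    using S by simp
  show "x = y \<and> y = z" if "S = 0"
  proof -
    have "\<not> 0 < T"
      using that S by simp
    then have "\<alpha>' = \<alpha>" "\<beta>' = \<beta>"
      using ln_sin_strict_monotone[OF ang ang'] unfolding T_def A_def B_def C_def by blast+
    then have "A = 0" "B = 0" "C = 0"
      using \<gamma> by (simp_all add: A_def B_def C_def)
    then show ?thesis
      using xyz by simp
  qed
qed

section \<open>Hyperbolic triangles\<close>

lemma cosh_bounds:
  fixes a b c :: real
  assumes "a < b + c" "b < a + c" "c < a + b"
  shows "cosh c < cosh a * cosh b + sinh a * sinh b" "cosh a * cosh b - sinh a * sinh b < cosh c"
proof -
  have pos: "0 < a" "0 < b" "0 < c"
    using assms by linarith+
  have "cosh c < cosh (a + b)"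
    using assms pos by (intro cosh_real_strict_mono) auto
  then show "cosh c < cosh a * cosh b + sinh a * sinh b"
    by (simp add: cosh_add)
  have "cosh \<bar>a - b\<bar> < cosh c"
    using assms pos by (intro cosh_real_strict_mono) auto
  then show "cosh a * cosh b - sinh a * sinh b < cosh c"
    by (simp add: cosh_diff)
qed

text \<open>The reversed Cauchy-Schwarz inequality on the hyperboloid. It puts the argument of
  \<open>arcosh\<close> in \<open>hyperbolic_dist\<close> into the range where \<open>cosh\<close>
  inverts it.\<close>

lemma minus_mink_ge_1:
  assumes "P \<in> hyperbolic_plane" "Q \<in> hyperbolic_plane"
  shows "1 \<le> - mink P Q"
proof -
  obtain x y z where P: "P = (x, y, z)" by (cases P)
  obtain x' y' z' where Q: "Q = (x', y', z')" by (cases Q)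
  have P1: "z\<^sup>2 = 1 + x\<^sup>2 + y\<^sup>2" "0 < z" and Q1: "z'\<^sup>2 = 1 + x'\<^sup>2 + y'\<^sup>2" "0 < z'"
    using assms by (auto simp: hyperbolic_plane_def P Q power2_eq_square)
  \<comment> \<open>Lagrange's identity for the vectors \<open>(1, x, y)\<close> and
    \<open>(1, x', y')\<close>, whose Euclidean norms are \<open>z\<close> and
    \<open>z'\<close>.\<close>
  have "(z * z')\<^sup>2 = (1 + x * x' + y * y')\<^sup>2 + (x - x')\<^sup>2 + (y - y')\<^sup>2 + (x * y' - y * x')\<^sup>2"
    unfolding power_mult_distrib P1 Q1 by algebra
  then have "(1 + x * x' + y * y')\<^sup>2 \<le> (z * z')\<^sup>2"
    by simp
  then have "1 + x * x' + y * y' \<le> z * z'"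
    by (rule power2_le_imp_le) (simp add: P1 Q1 less_imp_le)
  then show ?thesis
    by (simp add: P Q)
qed

lemma mink_eq_dist:
  assumes "P \<in> hyperbolic_plane" "Q \<in> hyperbolic_plane"
  shows "mink P Q = - cosh (hyperbolic_dist P Q)"
  using minus_mink_ge_1[OF assms] by (simp add: hyperbolic_dist_def)

lemma mink_linear:
  "mink (X + Y) Z = mink X Z + mink Y Z" "mink Z (X + Y) = mink Z X + mink Z Y"
  "mink (X - Y) Z = mink X Z - mink Y Z" "mink Z (X - Y) = mink Z X - mink Z Y"
  "mink (r *\<^sub>R X) Z = r * mink X Z" "mink Z (r *\<^sub>R X) = r * mink Z X"
  by (cases X; cases Y; cases Z; simp add: algebra_simps)+

lemma mink_commute: "mink X Y = mink Y X"
  by (cases X; cases Y; simp)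

text \<open>The geodesic directions at \<open>P\<close> have Minkowski lengths \<open>sinh a\<close>
  and \<open>sinh b\<close> and product \<open>cosh a * cosh b - cosh c\<close>, which makes the
  angle unique. As in the Euclidean case, existence needs an explicit triangle.\<close>

lemma hyperbolic_angle_eq:
  assumes "a < b + c" "b < a + c" "c < a + b"
  shows "hyperbolic_angle a b c = arccos ((cosh a * cosh b - cosh c) / (sinh a * sinh b))"
  unfolding hyperbolic_angle_def
proof (rule the_equality)
  have pos: "0 < a" "0 < b" "0 < c"
    using assms by linarith+
  have sq: "cosh t * cosh t = 1 + sinh t * sinh t" for t :: real
    using cosh_square_eq[of t] by (simp add: power2_eq_square)
  define q where "q = (cosh a * cosh b - cosh c) / (sinh a * sinh b)"
  have eq: "hyperbolic_vertex_angle P Q R = arccos q"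
    if "P \<in> hyperbolic_plane" "Q \<in> hyperbolic_plane" "R \<in> hyperbolic_plane"
      "hyperbolic_dist P Q = a" "hyperbolic_dist P R = b" "hyperbolic_dist Q R = c" for P Q R
  proof -
    have PQ: "mink P Q = - cosh a" "mink P R = - cosh b" "mink Q R = - cosh c"
      using that mink_eq_dist by blast+
    have self: "mink P P = -1" "mink Q Q = -1" "mink R R = -1"
      using that by (simp_all add: hyperbolic_plane_def)
    have "mink (geodesic_direction P Q) (geodesic_direction P Q) = (sinh a)\<^sup>2"
      "mink (geodesic_direction P R) (geodesic_direction P R) = (sinh b)\<^sup>2"
      "mink (geodesic_direction P Q) (geodesic_direction P R) = cosh a * cosh b - cosh c"
      using PQ self mink_commute[of Q P] mink_commute[of R P]
      by (simp_all add: geodesic_direction_def mink_linear power2_eq_square sq)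
    then show ?thesis
      using pos by (simp add: hyperbolic_vertex_angle_def Let_def q_def)
  qed
  then show "\<theta> = arccos ((cosh a * cosh b - cosh c) / (sinh a * sinh b))"
    if "\<exists>P\<in>hyperbolic_plane. \<exists>Q\<in>hyperbolic_plane. \<exists>R\<in>hyperbolic_plane.
          hyperbolic_dist P Q = a \<and> hyperbolic_dist P R = b \<and> hyperbolic_dist Q R = c \<and>
          \<theta> = hyperbolic_vertex_angle P Q R" for \<theta>
    using that unfolding q_def by blast
  have q: "-1 < q" "q < 1"
    using cosh_bounds[OF assms] pos by (simp_all add: q_def field_simps)
  then have q2: "1 - q\<^sup>2 \<ge> 0"
    by (simp add: abs_square_le_1)
  \<comment> \<open>At the apex of the hyperboloid the tangent space is the horizontal Euclidean
    plane, so \<open>Q\<close> and \<open>R\<close> are given in polar coordinates around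
    \<open>P\<close>.\<close>
  define P :: minkowski where "P = (0, 0, 1)"
  define Q :: minkowski where "Q = (sinh a, 0, cosh a)"
  define R :: minkowski where "R = (sinh b * q, sinh b * sqrt (1 - q\<^sup>2), cosh b)"
  have "P \<in> hyperbolic_plane" "Q \<in> hyperbolic_plane"
    by (simp_all add: P_def Q_def hyperbolic_plane_def sq)
  moreover have "R \<in> hyperbolic_plane"
  proof -
    have "(sinh b * q) * (sinh b * q) + (sinh b * sqrt (1 - q\<^sup>2)) * (sinh b * sqrt (1 - q\<^sup>2))
        = sinh b * sinh b * (q\<^sup>2 + sqrt (1 - q\<^sup>2) * sqrt (1 - q\<^sup>2))"
      by (simp add: power2_eq_square algebra_simps)
    also have "\<dots> = sinh b * sinh b"
      using q2 by simp
    finally show ?thesis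
      by (simp add: R_def hyperbolic_plane_def sq)
  qed
  moreover have "hyperbolic_dist P Q = a" "hyperbolic_dist P R = b"
    using pos by (simp_all add: hyperbolic_dist_def P_def Q_def R_def arcosh_cosh_real)
  moreover have "mink Q R = - cosh c"
    using pos by (simp add: Q_def R_def q_def field_simps)
  then have "hyperbolic_dist Q R = c"
    using pos by (simp add: hyperbolic_dist_def arcosh_cosh_real)
  ultimately show "\<exists>P\<in>hyperbolic_plane. \<exists>Q\<in>hyperbolic_plane. \<exists>R\<in>hyperbolic_plane.
          hyperbolic_dist P Q = a \<and> hyperbolic_dist P R = b \<and> hyperbolic_dist Q R = c \<and>
          arccos ((cosh a * cosh b - cosh c) / (sinh a * sinh b)) = hyperbolic_vertex_angle P Q R"
    using eq unfolding q_def by metis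
qed

text \<open>The expression under the root is the determinant of the symmetric matrix with diagonal 1
  and the hyperbolic cosines of the sides elsewhere. Being symmetric in the sides, it serves all
  three angles.\<close>

lemma hyperbolic_angle_cos_sin:
  assumes "a < b + c" "b < a + c" "c < a + b"
  shows "0 < hyperbolic_angle a b c" "hyperbolic_angle a b c < pi"
    "cos (hyperbolic_angle a b c) = (cosh a * cosh b - cosh c) / (sinh a * sinh b)"
    "sin (hyperbolic_angle a b c)
      = sqrt (1 + 2 * cosh a * cosh b * cosh c - (cosh a)\<^sup>2 - (cosh b)\<^sup>2 - (cosh c)\<^sup>2) / (sinh a * sinh b)"
    "1 + 2 * cosh a * cosh b * cosh c - (cosh a)\<^sup>2 - (cosh b)\<^sup>2 - (cosh c)\<^sup>2 > 0"
proof -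
  have pos: "0 < a" "0 < b" "0 < c"
    using assms by linarith+
  let ?q = "(cosh a * cosh b - cosh c) / (sinh a * sinh b)"
  let ?D = "1 + 2 * cosh a * cosh b * cosh c - (cosh a)\<^sup>2 - (cosh b)\<^sup>2 - (cosh c)\<^sup>2"
  note eq = hyperbolic_angle_eq[OF assms]
  have q: "-1 < ?q" "?q < 1"
    using cosh_bounds[OF assms] pos by (simp_all add: field_simps)
  show "0 < hyperbolic_angle a b c" "hyperbolic_angle a b c < pi"
    using q arccos_lt_bounded unfolding eq by blast+
  show "cos (hyperbolic_angle a b c) = ?q"
    using q unfolding eq by (intro cos_arccos) auto
  have D: "1 - ?q\<^sup>2 = ?D / (sinh a * sinh b)\<^sup>2"
  proof -
    have "?D = (sinh a * sinh b)\<^sup>2 - (cosh a * cosh b - cosh c)\<^sup>2"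
      unfolding power_mult_distrib sinh_square_eq by algebra
    then show ?thesis
      using pos by (simp add: power_divide diff_divide_distrib[of "(sinh a * sinh b)\<^sup>2"])
  qed
  have "sin (hyperbolic_angle a b c) = sqrt (1 - ?q\<^sup>2)"
    using q unfolding eq by (intro sin_arccos) auto
  also have "\<dots> = sqrt ?D / (sinh a * sinh b)"
    unfolding D using pos by (simp add: real_sqrt_divide)
  finally show "sin (hyperbolic_angle a b c) = sqrt ?D / (sinh a * sinh b)" .
  have "?q\<^sup>2 < 1"
    using q by (simp add: abs_square_less_1)
  then have "0 < ?D / (sinh a * sinh b)\<^sup>2"
    unfolding D[symmetric] by simp
  then show "?D > 0"
    using pos by (simp add: zero_less_divide_iff)
qed

section \<open>Sides of a hyperbolic triangle in terms of its angles\<close>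

lemma hyperbolic_dual_law_of_cosines:
  assumes "a < b + c" "b < a + c" "c < a + b"
  shows "cosh a * (sin (hyperbolic_angle a c b) * sin (hyperbolic_angle a b c))
    = cos (hyperbolic_angle b c a) + cos (hyperbolic_angle a c b) * cos (hyperbolic_angle a b c)"
proof -
  have pos: "0 < a" "0 < b" "0 < c"
    using assms by linarith+
  define D where "D = 1 + 2 * cosh a * cosh b * cosh c - (cosh a)\<^sup>2 - (cosh b)\<^sup>2 - (cosh c)\<^sup>2"
  have D: "D > 0"
    using hyperbolic_angle_cos_sin(5)[OF assms] by (simp add: D_def)
  have A: "cos (hyperbolic_angle b c a) = (cosh b * cosh c - cosh a) / (sinh b * sinh c)"
    using hyperbolic_angle_cos_sin(3)[of b c a] assms by (simp add: add.commute)
  have B: "cos (hyperbolic_angle a c b) = (cosh a * cosh c - cosh b) / (sinh a * sinh c)"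
    "sin (hyperbolic_angle a c b) = sqrt D / (sinh a * sinh c)"
    using hyperbolic_angle_cos_sin(3,4)[of a c b] assms
    by (simp_all add: D_def add.commute mult_ac diff_right_commute)
  have C: "cos (hyperbolic_angle a b c) = (cosh a * cosh b - cosh c) / (sinh a * sinh b)"
    "sin (hyperbolic_angle a b c) = sqrt D / (sinh a * sinh b)"
    using hyperbolic_angle_cos_sin(3,4)[OF assms] by (simp_all add: D_def)
  \<comment> \<open>Both sides of the claim have the common denominator
    \<open>(sinh a)\<^sup>2 * sinh b * sinh c\<close>; this is the equality of the numerators, a
    polynomial identity in the hyperbolic cosines.\<close>
  have "cosh a * D = (cosh b * cosh c - cosh a) * (sinh a)\<^sup>2
      + (cosh a * cosh c - cosh b) * (cosh a * cosh b - cosh c)"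
    unfolding sinh_square_eq D_def by algebra
  moreover have "cosh a * (sin (hyperbolic_angle a c b) * sin (hyperbolic_angle a b c))
      = cosh a * D / ((sinh a)\<^sup>2 * sinh b * sinh c)"
    using D unfolding B C by (simp add: power2_eq_square mult_ac)
  moreover have "cos (hyperbolic_angle b c a) + cos (hyperbolic_angle a c b) * cos (hyperbolic_angle a b c)
      = ((cosh b * cosh c - cosh a) * (sinh a)\<^sup>2
        + (cosh a * cosh c - cosh b) * (cosh a * cosh b - cosh c)) / ((sinh a)\<^sup>2 * sinh b * sinh c)"
  proof -
    have "X / (q * r) + Y / (p * r) * (Z / (p * q)) = (X * p\<^sup>2 + Y * Z) / (p\<^sup>2 * q * r)"
      if "p > 0" "q > 0" "r > 0" for X Y Z p q r :: real
      using that by (simp add: field_simps power2_eq_square)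
    then show ?thesis
      unfolding A B C using pos by simp
  qed
  ultimately show ?thesis
    by simp
qed

lemma cos_add_cos_half:
  fixes \<alpha> \<beta> \<gamma> s :: real
  assumes "2 * s = \<alpha> + \<beta> + \<gamma>"
  shows "cos \<alpha> + cos (\<beta> + \<gamma>) = 2 * cos s * cos (s - \<alpha>)"
proof -
  have *: "\<alpha> = s - (s - \<alpha>)" "\<beta> + \<gamma> = s + (s - \<alpha>)"
    using assms by auto
  have "cos (s - t) + cos (s + t) = 2 * cos s * cos t" for t
    by (simp add: cos_diff cos_add)
  from this[of "s - \<alpha>"] show ?thesis
    by (simp add: *(2))
qed

text \<open>If the sum were at least \<open>pi\<close>, each cosine hypothesis would make the other
  two angles exceed the first by more than \<open>pi\<close> (the fact \<open>large\<close>). Adding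
  two of these inequalities makes the third angle larger than \<open>pi\<close>.\<close>

lemma angle_sum_less_pi:
  fixes \<alpha> \<beta> \<gamma> :: real
  assumes "0 < \<alpha>" "\<alpha> < pi" "0 < \<beta>" "\<beta> < pi" "0 < \<gamma>" "\<gamma> < pi"
    and "0 < cos \<alpha> + cos (\<beta> + \<gamma>)" "0 < cos \<beta> + cos (\<alpha> + \<gamma>)" "0 < cos \<gamma> + cos (\<alpha> + \<beta>)"
  shows "\<alpha> + \<beta> + \<gamma> < pi"
proof (rule ccontr)
  assume sum: "\<not> \<alpha> + \<beta> + \<gamma> < pi"
  have large: "p + pi < q + r" if "0 < p" "p < pi" "0 < q" "q < pi" "0 < r" "r < pi"
    "pi \<le> p + q + r" "0 < cos p + cos (q + r)" for p q r :: real
  proof (rule ccontr)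
    assume "\<not> p + pi < q + r"
    \<comment> \<open>The lower bound \<open>- p\<close> comes from the angle sum being at least
      \<open>pi\<close>. The cosine decreases on \<open>[0, pi]\<close>, which contradicts the
      positive cosine sum.\<close>
    then have "\<bar>q + r - pi\<bar> \<le> p"
      using that by linarith
    then have "cos p \<le> cos \<bar>q + r - pi\<bar>"
      using that by (intro cos_monotone_0_pi_le) auto
    also have "\<dots> = - cos (q + r)"
      by (simp add: cos_diff)
    finally show False
      using that by simp
  qed
  show False
    using large[of \<alpha> \<beta> \<gamma>] large[of \<beta> \<alpha> \<gamma>] sum assms by auto
qed

text \<open>
  The half-side formula: \<open>cos s\<close> and \<open>cos (s - \<alpha>)\<close> are the sines of the angles \<open>\<pi>/2 - s\<close> and
  \<open>\<pi>/2 - s + \<alpha>\<close>, which makes the sides accessible to \<open>ln_sin_monotone\<close>.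
\<close>

lemma hyperbolic_half_side:
  fixes a b c :: real
  assumes tri: "a < b + c" "b < a + c" "c < a + b"
  defines "\<alpha> \<equiv> hyperbolic_angle b c a" and "\<beta> \<equiv> hyperbolic_angle a c b" and "\<gamma> \<equiv> hyperbolic_angle a b c"
  assumes s: "2 * s = \<alpha> + \<beta> + \<gamma>"
  shows "(sinh (a / 2))\<^sup>2 * (sin \<beta> * sin \<gamma>) = cos s * cos (s - \<alpha>)"
proof -
  have "2 * (sinh (a / 2))\<^sup>2 = cosh a - 1"
    using cosh_double[of "a / 2"] by (simp add: cosh_square_eq)
  moreover have "(cosh a - 1) * (sin \<beta> * sin \<gamma>) = cos \<alpha> + cos (\<beta> + \<gamma>)"
    using hyperbolic_dual_law_of_cosines[OF tri]
    by (simp add: \<alpha>_def \<beta>_def \<gamma>_def cos_add algebra_simps)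
  ultimately have "2 * (sinh (a / 2))\<^sup>2 * (sin \<beta> * sin \<gamma>) = 2 * (cos s * cos (s - \<alpha>))"
    using cos_add_cos_half[OF s] by simp
  then show ?thesis
    by simp
qed

lemma hyperbolic_angle_commute:
  assumes "a < b + c" "b < a + c" "c < a + b"
  shows "hyperbolic_angle b a c = hyperbolic_angle a b c"
  using assms by (simp add: hyperbolic_angle_eq add.commute mult.commute)

text \<open>The angle defect is positive because the dual law of cosines turns each sum
  \<open>cos \<alpha> + cos (\<beta> + \<gamma>)\<close> into
  \<open>(cosh a - 1) * (sin \<beta> * sin \<gamma>)\<close>, which is positive.\<close>

lemma hyperbolic_angles:
  fixes a b c :: real
  assumes tri: "a < b + c" "b < a + c" "c < a + b"
  shows "0 < hyperbolic_angle b c a" "0 < hyperbolic_angle a c b" "0 < hyperbolic_angle a b c"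
    "hyperbolic_angle b c a + hyperbolic_angle a c b + hyperbolic_angle a b c < pi"
proof -
  define \<alpha> \<beta> \<gamma> where "\<alpha> = hyperbolic_angle b c a" and "\<beta> = hyperbolic_angle a c b"
    and "\<gamma> = hyperbolic_angle a b c"
  note defs = this[symmetric]
  have ang: "0 < \<alpha>" "\<alpha> < pi" "0 < \<beta>" "\<beta> < pi" "0 < \<gamma>" "\<gamma> < pi"
    using hyperbolic_angle_cos_sin(1,2)[of b c a] hyperbolic_angle_cos_sin(1,2)[of a c b]
      hyperbolic_angle_cos_sin(1,2)[of a b c] tri by (simp_all add: add.commute defs)
  then have sin: "sin \<alpha> > 0" "sin \<beta> > 0" "sin \<gamma> > 0"
    by (auto intro: sin_gt_zero)
  have cosh: "cosh x > 1" if "x > 0" for x :: real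
    using cosh_real_strict_mono[of 0 x] that by simp
  have side: "0 < a" "0 < b" "0 < c"
    using tri by linarith+
  have "cos \<alpha> + cos (\<beta> + \<gamma>) = (cosh a - 1) * (sin \<beta> * sin \<gamma>)"
    using hyperbolic_dual_law_of_cosines[OF tri] by (simp add: defs cos_add algebra_simps)
  moreover have "cos \<beta> + cos (\<alpha> + \<gamma>) = (cosh b - 1) * (sin \<alpha> * sin \<gamma>)"
    using hyperbolic_dual_law_of_cosines[of b a c] tri hyperbolic_angle_commute[OF tri]
    by (simp add: defs cos_add algebra_simps)
  moreover have "cos \<gamma> + cos (\<alpha> + \<beta>) = (cosh c - 1) * (sin \<alpha> * sin \<beta>)"
    using hyperbolic_dual_law_of_cosines[of c a b] tri hyperbolic_angle_commute[of a c b]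
      hyperbolic_angle_commute[of b c a]
    by (simp add: defs cos_add algebra_simps)
  ultimately have "\<alpha> + \<beta> + \<gamma> < pi"
    using cosh side sin ang by (intro angle_sum_less_pi) simp_all
  with ang show "0 < hyperbolic_angle b c a" "0 < hyperbolic_angle a c b" "0 < hyperbolic_angle a b c"
    "hyperbolic_angle b c a + hyperbolic_angle a c b + hyperbolic_angle a b c < pi"
    by (simp_all add: defs)
qed

text \<open>The counterpart of the logarithmic law of sines: the quantity scaled by a conformal
  change becomes linear in logarithmic sines of the angles, of the half defect
  \<open>\<sigma>\<close> and of their sums.\<close>

lemma hyperbolic_half_sides_ln:
  fixes a b c :: real
  assumes tri: "a < b + c" "b < a + c" "c < a + b"
  defines "\<alpha> \<equiv> hyperbolic_angle b c a" and "\<beta> \<equiv> hyperbolic_angle a c b" and "\<gamma> \<equiv> hyperbolic_angle a b c"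
  defines "\<sigma> \<equiv> (pi - \<alpha> - \<beta> - \<gamma>) / 2"
  shows "2 * ln (sinh (a / 2)) = ln (sin \<sigma>) + ln (sin (\<sigma> + \<alpha>)) - ln (sin \<beta>) - ln (sin \<gamma>)"
    "2 * ln (sinh (b / 2)) = ln (sin \<sigma>) + ln (sin (\<sigma> + \<beta>)) - ln (sin \<alpha>) - ln (sin \<gamma>)"
    "2 * ln (sinh (c / 2)) = ln (sin \<sigma>) + ln (sin (\<sigma> + \<gamma>)) - ln (sin \<alpha>) - ln (sin \<beta>)"
proof -
  have side: "0 < a" "0 < b" "0 < c"
    using tri by linarith+
  define s where "s = (\<alpha> + \<beta> + \<gamma>) / 2"
  have \<sigma>: "\<sigma> = pi / 2 - s"
    by (simp add: \<sigma>_def s_def diff_divide_distrib add_divide_distrib)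
  have ang: "0 < \<alpha>" "0 < \<beta>" "0 < \<gamma>" "\<alpha> + \<beta> + \<gamma> < pi"
    using hyperbolic_angles[OF tri] by (simp_all add: \<alpha>_def \<beta>_def \<gamma>_def)
  then have sin: "sin \<alpha> > 0" "sin \<beta> > 0" "sin \<gamma> > 0"
    by (auto intro!: sin_gt_zero)
  have \<sigma>2: "2 * \<sigma> = pi - \<alpha> - \<beta> - \<gamma>"
    by (simp add: \<sigma>_def)
  have sin_\<sigma>: "sin \<sigma> > 0" "sin (\<sigma> + \<alpha>) > 0" "sin (\<sigma> + \<beta>) > 0" "sin (\<sigma> + \<gamma>) > 0"
    by (rule sin_gt_zero; use ang \<sigma>2 in linarith)+
  have cos: "cos s = sin \<sigma>" "cos (s - t) = sin (\<sigma> + t)" for t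
    by (simp_all add: \<sigma> sin_add cos_diff sin_diff)
  have ln: "2 * ln x = ln p + ln q - ln y - ln z"
    if "x\<^sup>2 * (y * z) = p * q" "0 < x" "0 < y" "0 < z" "0 < p" "0 < q" for x y z p q :: real
  proof -
    have "ln (x\<^sup>2 * (y * z)) = 2 * ln x + (ln y + ln z)" "ln (p * q) = ln p + ln q"
      using that(2-) by (simp_all add: ln_mult ln_realpow)
    then show ?thesis
      using that(1) by simp
  qed
  have comm: "hyperbolic_angle c a b = \<beta>" "hyperbolic_angle c b a = \<alpha>" "hyperbolic_angle b a c = \<gamma>"
    using hyperbolic_angle_commute[of a c b] hyperbolic_angle_commute[of b c a]
      hyperbolic_angle_commute[of a b c] tri
    by (simp_all add: \<alpha>_def \<beta>_def \<gamma>_def add.commute)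
  have half: "(sinh (a / 2))\<^sup>2 * (sin \<beta> * sin \<gamma>) = sin \<sigma> * sin (\<sigma> + \<alpha>)"
    "(sinh (b / 2))\<^sup>2 * (sin \<alpha> * sin \<gamma>) = sin \<sigma> * sin (\<sigma> + \<beta>)"
    "(sinh (c / 2))\<^sup>2 * (sin \<alpha> * sin \<beta>) = sin \<sigma> * sin (\<sigma> + \<gamma>)"
    using hyperbolic_half_side[of a b c s] hyperbolic_half_side[of b a c s] hyperbolic_half_side[of c a b s] tri
    unfolding comm \<alpha>_def[symmetric] \<beta>_def[symmetric] \<gamma>_def[symmetric] cos
    by (simp_all add: s_def add.commute add.left_commute)
  show "2 * ln (sinh (a / 2)) = ln (sin \<sigma>) + ln (sin (\<sigma> + \<alpha>)) - ln (sin \<beta>) - ln (sin \<gamma>)"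
    "2 * ln (sinh (b / 2)) = ln (sin \<sigma>) + ln (sin (\<sigma> + \<beta>)) - ln (sin \<alpha>) - ln (sin \<gamma>)"
    "2 * ln (sinh (c / 2)) = ln (sin \<sigma>) + ln (sin (\<sigma> + \<gamma>)) - ln (sin \<alpha>) - ln (sin \<beta>)"
    by (rule ln; use half side sin sin_\<sigma> in simp)+
qed

section \<open>Angle variation in a hyperbolic triangle\<close>

text \<open>The half defect takes the place of the free scale of the Euclidean case. It is fixed by
  the angles, so equality forces all logarithmic changes to vanish and leaves no common
  constant.\<close>

lemma hyperbolic_angle_variation:
  fixes a b c a' b' c' x y z :: real
  assumes tri: "a < b + c" "b < a + c" "c < a + b" and tri': "a' < b' + c'" "b' < a' + c'" "c' < a' + b'"
    and conf: "sinh (a' / 2) = sinh (a / 2) * exp ((y + z) / 2)" "sinh (b' / 2) = sinh (b / 2) * exp ((x + z) / 2)"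
      "sinh (c' / 2) = sinh (c / 2) * exp ((x + y) / 2)"
  defines "S \<equiv> x * (hyperbolic_angle b' c' a' - hyperbolic_angle b c a)
      + y * (hyperbolic_angle a' c' b' - hyperbolic_angle a c b)
      + z * (hyperbolic_angle a' b' c' - hyperbolic_angle a b c)"
  shows "S \<le> 0" and "S = 0 \<Longrightarrow> x = 0 \<and> y = 0 \<and> z = 0"
proof -
  define \<alpha> \<beta> \<gamma> \<sigma> where "\<alpha> = hyperbolic_angle b c a" and "\<beta> = hyperbolic_angle a c b"
    and "\<gamma> = hyperbolic_angle a b c" and "\<sigma> = (pi - \<alpha> - \<beta> - \<gamma>) / 2"
  define \<alpha>' \<beta>' \<gamma>' \<sigma>' where "\<alpha>' = hyperbolic_angle b' c' a'" and "\<beta>' = hyperbolic_angle a' c' b'"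
    and "\<gamma>' = hyperbolic_angle a' b' c'" and "\<sigma>' = (pi - \<alpha>' - \<beta>' - \<gamma>') / 2"
  have "2 * \<sigma> = pi - \<alpha> - \<beta> - \<gamma>"
    by (simp add: \<sigma>_def)
  then have ang: "0 < \<alpha>" "0 < \<beta>" "0 < \<gamma>" "0 < \<sigma>" "\<alpha> + \<beta> + \<gamma> + 2 * \<sigma> = pi"
    using hyperbolic_angles[OF tri, folded \<alpha>_def \<beta>_def \<gamma>_def] by linarith+
  have "2 * \<sigma>' = pi - \<alpha>' - \<beta>' - \<gamma>'"
    by (simp add: \<sigma>'_def)
  then have ang': "0 < \<alpha>'" "0 < \<beta>'" "0 < \<gamma>'" "0 < \<sigma>'" "\<alpha>' + \<beta>' + \<gamma>' + 2 * \<sigma>' = pi"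
    using hyperbolic_angles[OF tri', folded \<alpha>'_def \<beta>'_def \<gamma>'_def] by linarith+
  define L where "L t t' = ln (sin t') - ln (sin t)" for t t' :: real
  define A B C A2 B2 C2 D where "A = L \<alpha> \<alpha>'" and "B = L \<beta> \<beta>'" and "C = L \<gamma> \<gamma>'"
    and "A2 = L (\<sigma> + \<alpha>) (\<sigma>' + \<alpha>')" and "B2 = L (\<sigma> + \<beta>) (\<sigma>' + \<beta>')" and "C2 = L (\<sigma> + \<gamma>) (\<sigma>' + \<gamma>')"
    and "D = L \<sigma> \<sigma>'"
  note L_defs = this
  have side: "0 < a" "0 < b" "0 < c"
    using tri by linarith+
  have ln_conf: "w = 2 * ln (sinh (q / 2)) - 2 * ln (sinh (p / 2))"
    if "sinh (q / 2) = sinh (p / 2) * exp (w / 2)" "0 < p" for p q w :: real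
    using that by (simp add: ln_mult)
  have sums: "y + z = D + A2 - B - C" "x + z = D + B2 - A - C" "x + y = D + C2 - A - B"
    using ln_conf[OF conf(1) side(1)] ln_conf[OF conf(2) side(2)] ln_conf[OF conf(3) side(3)]
      hyperbolic_half_sides_ln[OF tri, folded \<alpha>_def \<beta>_def \<gamma>_def, folded \<sigma>_def]
      hyperbolic_half_sides_ln[OF tri', folded \<alpha>'_def \<beta>'_def \<gamma>'_def, folded \<sigma>'_def]
    by (simp_all add: L_defs L_def)
  then have xyz: "x = (D + B2 + C2 - A2) / 2 - A" "y = (D + A2 + C2 - B2) / 2 - B"
      "z = (D + A2 + B2 - C2) / 2 - C"
    by argo+
  define p q r where "p = \<alpha>' - \<alpha>" and "q = \<beta>' - \<beta>" and "r = \<gamma>' - \<gamma>"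
  note pqr = this
  define d where "d = - (p + q + r) / 2"
  have d: "\<sigma>' - \<sigma> = d"
    by (simp add: d_def p_def q_def r_def \<sigma>_def \<sigma>'_def field_simps)
  define T where "T t1 t2 t3 t1' t2' t3' = (t1' - t1) * L t1 t1' + (t2' - t2) * L t2 t2' + (t3' - t3) * L t3 t3'"
    for t1 t2 t3 t1' t2' t3' :: real
  have T: "0 \<le> T t1 t2 t3 t1' t2' t3'"
    if "0 < t1" "0 < t2" "0 < t3" "t1 + t2 + t3 = pi" "0 < t1'" "0 < t2'" "0 < t3'" "t1' + t2' + t3' = pi"
    for t1 t2 t3 t1' t2' t3'
    unfolding T_def L_def using that by (rule ln_sin_monotone)
  have T_strict: "0 < T t1 t2 t3 t1' t2' t3'"
    if "0 < t1" "0 < t2" "0 < t3" "t1 + t2 + t3 = pi" "0 < t1'" "0 < t2'" "0 < t3'" "t1' + t2' + t3' = pi"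
      "t1' \<noteq> t1 \<or> t2' \<noteq> t2"
    for t1 t2 t3 t1' t2' t3'
    unfolding T_def L_def using that by (rule ln_sin_strict_monotone)
  \<comment> \<open>The third angle \<open>pi - (\<sigma> + \<alpha>)\<close> has the same sine as
    \<open>\<sigma> + \<alpha>\<close>, so its logarithmic change is again
    \<open>A2\<close>.\<close>
  have L_pi: "L (pi - t) (pi - t') = L t t'" for t t'
    by (simp add: L_def)
  txt \<open>
    Each of the triples \<open>(\<alpha>, \<sigma> + \<beta>, \<sigma> + \<gamma>)\<close> and \<open>(\<sigma>, \<alpha>, \<pi> - (\<sigma> + \<alpha>))\<close> is the triple of angles of a
    Euclidean triangle; the weights 2 and 1 are those for which the terms add up to \<open>S\<close>.
  \<close>
  define T1 where "T1 = T \<alpha> (\<sigma> + \<beta>) (\<sigma> + \<gamma>) \<alpha>' (\<sigma>' + \<beta>') (\<sigma>' + \<gamma>')"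
  define T2 where "T2 = T \<beta> (\<sigma> + \<alpha>) (\<sigma> + \<gamma>) \<beta>' (\<sigma>' + \<alpha>') (\<sigma>' + \<gamma>')"
  define T3 where "T3 = T \<gamma> (\<sigma> + \<alpha>) (\<sigma> + \<beta>) \<gamma>' (\<sigma>' + \<alpha>') (\<sigma>' + \<beta>')"
  define U1 where "U1 = T \<sigma> \<alpha> (pi - (\<sigma> + \<alpha>)) \<sigma>' \<alpha>' (pi - (\<sigma>' + \<alpha>'))"
  define U2 where "U2 = T \<sigma> \<beta> (pi - (\<sigma> + \<beta>)) \<sigma>' \<beta>' (pi - (\<sigma>' + \<beta>'))"
  define U3 where "U3 = T \<sigma> \<gamma> (pi - (\<sigma> + \<gamma>)) \<sigma>' \<gamma>' (pi - (\<sigma>' + \<gamma>'))"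
  have delta: "(\<sigma>' + t') - (\<sigma> + t) = d + (t' - t)" "(pi - (\<sigma>' + t')) - (pi - (\<sigma> + t)) = - d - (t' - t)" for t t'
    using d by linarith+
  have "T1 = p * A + (d + q) * B2 + (d + r) * C2" "T2 = q * B + (d + p) * A2 + (d + r) * C2"
    "T3 = r * C + (d + p) * A2 + (d + q) * B2"
    "U1 = d * D + p * A + (- d - p) * A2" "U2 = d * D + q * B + (- d - q) * B2" "U3 = d * D + r * C + (- d - r) * C2"
    unfolding T1_def T2_def T3_def U1_def U2_def U3_def T_def delta d pqr L_pi L_defs by (rule refl)+
  \<comment> \<open>Comparison of coefficients: in the bracket \<open>A\<close> has
    \<open>3 * p\<close>, \<open>A2\<close> has \<open>3 * (d + p)\<close> with
    \<open>d + p = (p - q - r) / 2\<close>, and \<open>D\<close> has \<open>3 * d\<close>.\<close>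
  then have S: "3 * S = - (2 * T1 + 2 * T2 + 2 * T3 + U1 + U2 + U3)"
    unfolding S_def \<alpha>_def[symmetric] \<beta>_def[symmetric] \<gamma>_def[symmetric]
      \<alpha>'_def[symmetric] \<beta>'_def[symmetric] \<gamma>'_def[symmetric] pqr[symmetric] xyz d_def
    by (simp add: field_simps)
  have nonneg: "0 \<le> T1" "0 \<le> T2" "0 \<le> T3" "0 \<le> U1" "0 \<le> U2" "0 \<le> U3"
    unfolding T1_def T2_def T3_def U1_def U2_def U3_def
    by (rule T; use ang ang' in linarith)+
  then show "S \<le> 0"
    using S by linarith
  show "x = 0 \<and> y = 0 \<and> z = 0" if "S = 0"
  proof -
    \<comment> \<open>A vanishing sum of nonnegative terms with positive weights. The triples of
      \<open>U1\<close>, \<open>U2\<close>, \<open>U3\<close> contain \<open>\<sigma>\<close> and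
      all three angles between them, so their strictness fixes every angle.\<close>
    have "\<not> 0 < U1" "\<not> 0 < U2" "\<not> 0 < U3"
      using that S nonneg by linarith+
    have "\<sigma>' = \<sigma> \<and> \<alpha>' = \<alpha>"
      using T_strict[of \<sigma> \<alpha> "pi - (\<sigma> + \<alpha>)" \<sigma>' \<alpha>' "pi - (\<sigma>' + \<alpha>')"] \<open>\<not> 0 < U1\<close> ang ang'
      unfolding U1_def by argo
    moreover have "\<beta>' = \<beta>"
      using T_strict[of \<sigma> \<beta> "pi - (\<sigma> + \<beta>)" \<sigma>' \<beta>' "pi - (\<sigma>' + \<beta>')"] \<open>\<not> 0 < U2\<close> ang ang'
      unfolding U2_def by argo
    moreover have "\<gamma>' = \<gamma>"
      using T_strict[of \<sigma> \<gamma> "pi - (\<sigma> + \<gamma>)" \<sigma>' \<gamma>' "pi - (\<sigma>' + \<gamma>')"] \<open>\<not> 0 < U3\<close> ang ang'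
      unfolding U3_def by argo
    ultimately have "A = 0" "B = 0" "C = 0" "A2 = 0" "B2 = 0" "C2 = 0" "D = 0"
      by (simp_all add: L_defs L_def)
    then show ?thesis
      using xyz by simp
  qed
qed

section \<open>Simplicial complexes of triangles\<close>

text \<open>The definition of a simplex only supplies some affinely independent \<open>C\<close>
  with the same hull. The extreme points recover \<open>C\<close> from the hull, and counting gives
  \<open>C = {i, j, k}\<close>; a face thus determines its corners.\<close>

lemma extreme_points_triangle:
  fixes i j k :: "'a::euclidean_space"
  assumes "2 simplex (convex hull {i, j, k})"
  shows "{v. v extreme_point_of (convex hull {i, j, k})} = {i, j, k}"
    and "\<not> affine_dependent {i, j, k}" and "i \<noteq> j" "i \<noteq> k" "j \<noteq> k"
proof -
  obtain C where C: "\<not> affine_dependent C" "int (card C) = 2 + 1" "convex hull {i, j, k} = convex hull C"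
    using assms unfolding simplex_def by auto
  have ext: "{v. v extreme_point_of (convex hull C)} = C"
    using extreme_point_of_convex_hull_affine_independent[OF C(1)] by blast
  have sub: "C \<subseteq> {i, j, k}"
    using ext C(3) extreme_point_of_convex_hull by (metis mem_Collect_eq subsetI)
  moreover have "card {i, j, k} \<le> 3"
    by (rule card_insert_le_m1 | simp)+
  ultimately have eq: "C = {i, j, k}"
    using C(2) by (intro card_seteq) auto
  show "{v. v extreme_point_of (convex hull {i, j, k})} = {i, j, k}"
    using ext eq by simp
  show "\<not> affine_dependent {i, j, k}"
    using C(1) eq by simp
  have "card {i, j, k} = 3"
    using C(2) eq by simp
  then show "i \<noteq> j" "i \<noteq> k" "j \<noteq> k"
    by (auto simp: card_insert_if split: if_splits)
qed

lemma faceE: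
  assumes "f \<in> faces \<T>"
  obtains i j k where "f = convex hull {i, j, k}" "i \<noteq> j" "i \<noteq> k" "j \<noteq> k"
proof -
  obtain C where C: "card C = 3" "f = convex hull C"
    using assms unfolding faces_def simplex_def by auto
  then obtain i j k where "C = {i, j, k}" "i \<noteq> j" "i \<noteq> k" "j \<noteq> k"
    unfolding card_3_iff by blast
  with C that show ?thesis by blast
qed

context
  fixes \<T> :: "'a::euclidean_space set set"
  assumes complex: "simplicial_complex \<T>"
begin

lemma edges_of_face:
  assumes "convex hull {i, j, k} \<in> faces \<T>"
  shows "edge i j \<in> edges \<T>"
proof -
  have f: "convex hull {i, j, k} \<in> \<T>" "2 simplex (convex hull {i, j, k})"
    using assms by (auto simp: faces_def)
  have "edge i j face_of (convex hull {i, j, k})"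
    unfolding face_of_convex_hull_affine_independent[OF extreme_points_triangle(2)[OF f(2)]]
    by (intro exI[of _ "{i, j}"]) simp
  then have "edge i j \<in> \<T>"
    using complex f(1) unfolding simplicial_complex_def by blast
  moreover have "1 simplex (edge i j)"
    using one_simplex_segment[OF extreme_points_triangle(3)[OF f(2)]] by (simp add: segment_convex_hull)
  ultimately show ?thesis
    by (simp add: edges_def)
qed

text \<open>A vertex of the complex that lies in a face is one of its corners, since two simplices
  of a complex meet in a common face. This makes the sum over the vertices in a face a sum of three
  terms.\<close>

lemma vertices_of_face:
  assumes "convex hull {i, j, k} \<in> faces \<T>"
  shows "vertices \<T> \<inter> convex hull {i, j, k} = {i, j, k}"
proof -
  have f: "convex hull {i, j, k} \<in> \<T>" "2 simplex (convex hull {i, j, k})"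
    using assms by (auto simp: faces_def)
  have "v \<in> vertices \<T> \<inter> convex hull {i, j, k} \<longleftrightarrow> v extreme_point_of (convex hull {i, j, k})" for v
  proof
    assume "v \<in> vertices \<T> \<inter> convex hull {i, j, k}"
    then have "{v} \<in> \<T>" "convex hull {i, j, k} \<inter> {v} = {v}"
      by (auto simp: vertices_def)
    then have "{v} face_of (convex hull {i, j, k})"
      using complex f(1) unfolding simplicial_complex_def by metis
    then show "v extreme_point_of (convex hull {i, j, k})"
      by (simp add: face_of_singleton)
  next
    assume v: "v extreme_point_of (convex hull {i, j, k})"
    then have "{v} \<in> \<T>"
      using complex f(1) unfolding simplicial_complex_def by (metis face_of_singleton)
    then show "v \<in> vertices \<T> \<inter> convex hull {i, j, k}"
      using v by (simp add: vertices_def extreme_point_of_def)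
  qed
  then show ?thesis
    using extreme_points_triangle(1)[OF f(2)] by blast
qed

lemma finite_faces: "finite (faces \<T>)"
  using complex by (simp add: simplicial_complex_def faces_def)

lemma finite_vertices: "finite (vertices \<T>)"
proof -
  have "finite {x. {x} \<in> \<T>}"
    using complex by (intro finite_inverse_image[of \<T> "\<lambda>v. {v}"]) (auto simp: simplicial_complex_def)
  then show ?thesis
    by (simp add: vertices_def)
qed

text \<open>The intersection is compact and convex, hence has an extreme point. As the intersection
  is a face of \<open>f\<close>, that point is also extreme in \<open>f\<close> and so a vertex of
  the complex.\<close>

lemma face_Int_vertex:
  assumes "f \<in> faces \<T>" "g \<in> faces \<T>" "f \<inter> g \<noteq> {}"
  obtains v where "v \<in> vertices \<T>" "v \<in> f" "v \<in> g"
proof -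
  have T: "f \<in> \<T>" "g \<in> \<T>" and "2 simplex f" "2 simplex g"
    using assms by (auto simp: faces_def)
  then have "compact (f \<inter> g)" "convex (f \<inter> g)"
    by (auto intro: compact_Int compact_simplex convex_Int convex_simplex)
  then obtain v where v: "v extreme_point_of (f \<inter> g)"
    using assms(3) extreme_point_exists_convex by blast
  have "f \<inter> g face_of f"
    using complex T unfolding simplicial_complex_def by blast
  then have "{v} face_of f"
    using v extreme_point_of_face face_of_singleton by blast
  then have "{v} \<in> \<T>"
    using complex T unfolding simplicial_complex_def by blast
  then show ?thesis
    using v that by (auto simp: vertices_def extreme_point_of_def)
qed

section \<open>From single faces to the connected surface\<close>

text \<open>Topological connectedness is used directly, without edge paths. Faces carrying different
  values share no vertex and hence no point, so two different values would split the space into two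
  closed sets.\<close>

lemma constant_on_vertices:
  fixes w :: "'a \<Rightarrow> real"
  assumes cover: "\<forall>s\<in>\<T>. \<exists>f\<in>faces \<T>. s \<subseteq> f" and conn: "connected (\<Union>\<T>)"
    and const: "\<And>i j k. convex hull {i, j, k} \<in> faces \<T> \<Longrightarrow> w i = w j"
  shows "\<exists>t. \<forall>i\<in>vertices \<T>. w i = t"
proof (rule ccontr)
  assume contra: "\<not> ?thesis"
  have same: "w p = w q" if face: "f \<in> faces \<T>" and pq: "p \<in> vertices \<T> \<inter> f" "q \<in> vertices \<T> \<inter> f" for f p q
  proof -
    obtain i j k where f: "f = convex hull {i, j, k}"
      using face by (rule faceE)
    have "w i = w j" "w i = w k"
      using const[of i j k] const[of i k j] face f by (simp_all add: insert_commute)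
    then show ?thesis
      using pq face vertices_of_face[of i j k] unfolding f by auto
  qed
  obtain v where v: "v \<in> vertices \<T>"
    using contra by blast
  then obtain u where u: "u \<in> vertices \<T>" "w u \<noteq> w v"
    using contra by blast
  \<comment> \<open>Since \<open>w\<close> is constant on the corners of a face, each face belongs
    to exactly one of \<open>F\<close> and \<open>G\<close>. Finiteness makes both unions
    closed.\<close>
  define F where "F = {f \<in> faces \<T>. \<exists>p\<in>vertices \<T> \<inter> f. w p = w v}"
  define G where "G = {f \<in> faces \<T>. \<exists>p\<in>vertices \<T> \<inter> f. w p \<noteq> w v}"
  have face_vertex: "\<exists>p. p \<in> vertices \<T> \<inter> f" if "f \<in> faces \<T>" for f
    using that vertices_of_face by (metis faceE insertI1)
  have "finite F" "finite G"
    using finite_faces by (simp_all add: F_def G_def)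
  moreover have "closed f" if "f \<in> faces \<T>" for f
    using that closed_simplex by (auto simp: faces_def)
  ultimately have closed: "closed (\<Union>F)" "closed (\<Union>G)"
    by (auto simp: F_def G_def intro!: closed_Union)
  have in_F: "w p = w v" if f: "f \<in> F" and p: "p \<in> vertices \<T> \<inter> f" for f p
  proof -
    obtain q where "q \<in> vertices \<T> \<inter> f" "w q = w v" and "f \<in> faces \<T>"
      using f by (auto simp: F_def)
    then show ?thesis
      using same[of f p q] p by simp
  qed
  have in_G: "w p \<noteq> w v" if f: "f \<in> G" and p: "p \<in> vertices \<T> \<inter> f" for f p
  proof -
    obtain q where "q \<in> vertices \<T> \<inter> f" "w q \<noteq> w v" and "f \<in> faces \<T>"
      using f by (auto simp: G_def)
    then show ?thesis
      using same[of f p q] p by simp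
  qed
  have "\<Union>\<T> \<subseteq> \<Union>F \<union> \<Union>G"
  proof
    fix x assume "x \<in> \<Union>\<T>"
    then obtain f where "f \<in> faces \<T>" "x \<in> f"
      using cover by blast
    moreover from this have "f \<in> F \<or> f \<in> G"
      using face_vertex[of f] by (auto simp: F_def G_def)
    ultimately show "x \<in> \<Union>F \<union> \<Union>G"
      by blast
  qed
  moreover have "\<Union>F \<inter> \<Union>G \<inter> \<Union>\<T> = {}"
  proof -
    have False if FG: "f \<in> F" "g \<in> G" and x: "x \<in> f" "x \<in> g" for f g x
    proof -
      have "f \<in> faces \<T>" "g \<in> faces \<T>" "f \<inter> g \<noteq> {}"
        using FG x by (auto simp: F_def G_def)
      then obtain p where "p \<in> vertices \<T>" "p \<in> f" "p \<in> g"
        by (rule face_Int_vertex)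
      then show False
        using in_F[OF FG(1)] in_G[OF FG(2)] by blast
    qed
    then show ?thesis by blast
  qed
  moreover have "v \<in> \<Union>F" "v \<in> \<Union>\<T>"
  proof -
    have "{v} \<in> \<T>"
      using v by (simp add: vertices_def)
    then obtain f where "f \<in> faces \<T>" "{v} \<subseteq> f"
      using cover by blast
    then have "f \<in> F" "v \<in> f"
      using v by (auto simp: F_def)
    then show "v \<in> \<Union>F" "v \<in> \<Union>\<T>"
      using \<open>{v} \<in> \<T>\<close> by blast+
  qed
  moreover have "u \<in> \<Union>G" "u \<in> \<Union>\<T>"
  proof -
    have "{u} \<in> \<T>"
      using u by (simp add: vertices_def)
    then obtain f where "f \<in> faces \<T>" "{u} \<subseteq> f"
      using cover by blast
    then have "f \<in> G" "u \<in> f"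
      using u by (auto simp: G_def)
    then show "u \<in> \<Union>G" "u \<in> \<Union>\<T>"
      using \<open>{u} \<in> \<T>\<close> by blast+
  qed
  ultimately show False
    using conn closed unfolding connected_closed by blast
qed

section \<open>Angles of faces and the sum of curvatures\<close>

text \<open>The hull determines \<open>{j, k}\<close> but not the order, so the definite description
  is meaningful once \<open>ang\<close> is symmetric in the two sides at \<open>i\<close>.\<close>

lemma face_angle_eq:
  assumes f: "convex hull {i, j, k} \<in> faces \<T>"
    and commute: "ang (l (edge i k)) (l (edge i j)) (l (edge j k)) = ang (l (edge i j)) (l (edge i k)) (l (edge j k))"
  shows "face_angle ang l (convex hull {i, j, k}) i = ang (l (edge i j)) (l (edge i k)) (l (edge j k))"
  unfolding face_angle_def
proof (rule the_equality)
  fix \<theta>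
  assume "\<exists>j' k'. convex hull {i, j, k} = convex hull {i, j', k'}
    \<and> \<theta> = ang (l (edge i j')) (l (edge i k')) (l (edge j' k'))"
  then obtain j' k' where h: "convex hull {i, j, k} = convex hull {i, j', k'}"
    and \<theta>: "\<theta> = ang (l (edge i j')) (l (edge i k')) (l (edge j' k'))"
    by blast
  have s: "2 simplex (convex hull {i, j, k})"
    using f by (simp add: faces_def)
  have "{i, j, k} = {i, j', k'}"
    using extreme_points_triangle(1)[OF s] extreme_points_triangle(1)[of i j' k'] s h by simp
  then have "j' = j \<and> k' = k \<or> j' = k \<and> k' = j"
    using extreme_points_triangle(3-5)[OF s] extreme_points_triangle(3-5)[of i j' k'] s h by auto
  then show "\<theta> = ang (l (edge i j)) (l (edge i k)) (l (edge j k))"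
    using \<theta> commute by (auto simp: insert_commute)
qed auto

text \<open>
  Summing \<open>w\<close> times the change of curvature over the vertices gives the sum over the faces of a
  quantity of constant sign, so this quantity vanishes on every face.
\<close>

lemma face_equality:
  fixes w :: "'a \<Rightarrow> real"
  assumes curv: "\<forall>i\<in>vertices \<T>. curvature ang \<T> l i = curvature ang \<T> l' i"
    and commute: "\<And>i j k. convex hull {i, j, k} \<in> faces \<T> \<Longrightarrow>
      ang (l (edge i k)) (l (edge i j)) (l (edge j k)) = ang (l (edge i j)) (l (edge i k)) (l (edge j k))"
    and commute': "\<And>i j k. convex hull {i, j, k} \<in> faces \<T> \<Longrightarrow>
      ang (l' (edge i k)) (l' (edge i j)) (l' (edge j k)) = ang (l' (edge i j)) (l' (edge i k)) (l' (edge j k))"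
  defines "\<Delta> \<equiv> \<lambda>i j k. ang (l' (edge i j)) (l' (edge i k)) (l' (edge j k)) - ang (l (edge i j)) (l (edge i k)) (l (edge j k))"
  assumes nonpos: "\<And>i j k. convex hull {i, j, k} \<in> faces \<T> \<Longrightarrow> w i * \<Delta> i j k + w j * \<Delta> j i k + w k * \<Delta> k i j \<le> 0"
    and f: "convex hull {i, j, k} \<in> faces \<T>"
  shows "w i * \<Delta> i j k + w j * \<Delta> j i k + w k * \<Delta> k i j = 0"
proof -
  define \<delta> where "\<delta> f v = face_angle ang l' f v - face_angle ang l f v" for f v
  have \<delta>: "\<delta> (convex hull {i, j, k}) i = \<Delta> i j k" if "convex hull {i, j, k} \<in> faces \<T>" for i j k
    using face_angle_eq[where ang = ang and l = l, OF that commute[OF that]]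
      face_angle_eq[where ang = ang and l = l', OF that commute'[OF that]]
    by (simp add: \<delta>_def \<Delta>_def)
  have local: "(\<Sum>v\<in>vertices \<T> \<inter> convex hull {i, j, k}. w v * \<delta> (convex hull {i, j, k}) v)
      = w i * \<Delta> i j k + w j * \<Delta> j i k + w k * \<Delta> k i j" if f: "convex hull {i, j, k} \<in> faces \<T>" for i j k
  proof -
    have "i \<noteq> j" "i \<noteq> k" "j \<noteq> k"
      using extreme_points_triangle(3-5)[of i j k] f by (simp_all add: faces_def)
    then show ?thesis
      using \<delta>[of i j k] \<delta>[of j i k] \<delta>[of k i j] f
      by (simp add: vertices_of_face[OF f] insert_commute)
  qed
  \<comment> \<open>The constants \<open>2 * pi\<close> cancel, so equal curvatures say that the
    angle changes at each vertex add up to zero.\<close>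
  have "0 = (\<Sum>v\<in>vertices \<T>. w v * (\<Sum>f\<in>{f \<in> faces \<T>. v \<in> f}. \<delta> f v))"
    using curv by (simp add: curvature_def \<delta>_def sum_subtractf)
  also have "\<dots> = (\<Sum>v\<in>vertices \<T>. \<Sum>f\<in>{f \<in> faces \<T>. v \<in> f}. w v * \<delta> f v)"
    by (simp add: sum_distrib_left)
  also have "\<dots> = (\<Sum>f\<in>faces \<T>. \<Sum>v\<in>{v \<in> vertices \<T>. v \<in> f}. w v * \<delta> f v)"
    by (rule sum.swap_restrict) (rule finite_vertices finite_faces)+
  finally have "(\<Sum>f\<in>faces \<T>. \<Sum>v\<in>vertices \<T> \<inter> f. w v * \<delta> f v) = 0"
    by (simp add: Int_def)
  moreover have "(\<Sum>v\<in>vertices \<T> \<inter> f. w v * \<delta> f v) \<le> 0" if "f \<in> faces \<T>" for f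
    using that
  proof (rule faceE)
    fix i j k assume "f = convex hull {i, j, k}"
    with that show ?thesis
      using local[of i j k] nonpos[of i j k] by simp
  qed
  ultimately have "\<forall>f\<in>faces \<T>. - (\<Sum>v\<in>vertices \<T> \<inter> f. w v * \<delta> f v) = 0"
    using finite_faces by (subst sum_nonneg_eq_0_iff[symmetric]) (simp_all add: sum_negf)
  then show ?thesis
    using f local[OF f] by simp
qed

end

section \<open>Rigidity\<close>

text \<open>The order matches \<open>a < b + c\<close>, \<open>b < a + c\<close>,
  \<open>c < a + b\<close>, where \<open>a\<close>, \<open>b\<close>, \<open>c\<close> are the sides
  opposite to \<open>i\<close>, \<open>j\<close>, \<open>k\<close>.\<close>

lemma discrete_metric_triangle:
  assumes "discrete_metric \<T> l" "convex hull {i, j, k} \<in> faces \<T>"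
  shows "l (edge j k) < l (edge i k) + l (edge i j)" "l (edge i k) < l (edge j k) + l (edge i j)"
    "l (edge i j) < l (edge j k) + l (edge i k)"
proof -
  have tri: "l (edge i' j') < l (edge i' k') + l (edge j' k')" if "{i', j', k'} = {i, j, k}" for i' j' k'
    using assms that unfolding discrete_metric_def by auto
  have sym: "edge k i = edge i k" "edge k j = edge j k" "edge j i = edge i j"
    by (simp_all add: insert_commute)
  show "l (edge j k) < l (edge i k) + l (edge i j)" "l (edge i k) < l (edge j k) + l (edge i j)"
    "l (edge i j) < l (edge j k) + l (edge i k)"
    using tri[of j k i] tri[of i k j] tri[of i j k] unfolding sym by (auto simp: add.commute)
qed

text \<open>Common form of both geometries: \<open>g\<close> is the function of the length that is
  scaled conformally, the identity or \<open>sinh (a / 2)\<close>, and \<open>E\<close> is what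
  equality in a single triangle implies.\<close>

lemma face_rigidity:
  fixes \<T> :: "'a::euclidean_space set set" and u u' :: "'a \<Rightarrow> real" and g :: "real \<Rightarrow> real"
  assumes complex: "simplicial_complex \<T>" and metric: "discrete_metric \<T> l" "discrete_metric \<T> l'"
    and factor: "\<And>i j. edge i j \<in> edges \<T> \<Longrightarrow> g (l (edge i j)) = g (base (edge i j)) * exp ((u i + u j) / 2)"
    and factor': "\<And>i j. edge i j \<in> edges \<T> \<Longrightarrow> g (l' (edge i j)) = g (base (edge i j)) * exp ((u' i + u' j) / 2)"
    and curv: "\<forall>i\<in>vertices \<T>. curvature ang \<T> l i = curvature ang \<T> l' i"
    and ang_commute: "\<And>a b c. a < b + c \<Longrightarrow> b < a + c \<Longrightarrow> c < a + b \<Longrightarrow> ang b a c = ang a b c"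
    and variation: "\<And>a b c a' b' c' x y z.
      \<lbrakk>a < b + c; b < a + c; c < a + b; a' < b' + c'; b' < a' + c'; c' < a' + b';
       g a' = g a * exp ((y + z) / 2); g b' = g b * exp ((x + z) / 2); g c' = g c * exp ((x + y) / 2)\<rbrakk> \<Longrightarrow>
      x * (ang b' c' a' - ang b c a) + y * (ang a' c' b' - ang a c b) + z * (ang a' b' c' - ang a b c) \<le> 0"
    and equality: "\<And>a b c a' b' c' x y z.
      \<lbrakk>a < b + c; b < a + c; c < a + b; a' < b' + c'; b' < a' + c'; c' < a' + b';
       g a' = g a * exp ((y + z) / 2); g b' = g b * exp ((x + z) / 2); g c' = g c * exp ((x + y) / 2);
       x * (ang b' c' a' - ang b c a) + y * (ang a' c' b' - ang a c b) + z * (ang a' b' c' - ang a b c) = 0\<rbrakk> \<Longrightarrow>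
      E x y z"
    and f: "convex hull {i, j, k} \<in> faces \<T>"
  shows "E (u' i - u i) (u' j - u j) (u' k - u k)"
proof -
  define w where "w v = u' v - u v" for v
  define \<Delta> where "\<Delta> i j k = ang (l' (edge i j)) (l' (edge i k)) (l' (edge j k))
      - ang (l (edge i j)) (l (edge i k)) (l (edge j k))" for i j k
  \<comment> \<open>The base metric cancels: \<open>l'\<close> is conformal to \<open>l\<close>
    itself with factor \<open>w\<close>.\<close>
  have scale: "g (l' (edge p q)) = g (l (edge p q)) * exp ((w p + w q) / 2)" if "edge p q \<in> edges \<T>" for p q
    using factor[OF that] factor'[OF that]
    by (simp add: w_def mult.assoc flip: exp_add add_divide_distrib)
  have commute: "ang (m (edge i k)) (m (edge i j)) (m (edge j k)) = ang (m (edge i j)) (m (edge i k)) (m (edge j k))"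
    if "discrete_metric \<T> m" "convex hull {i, j, k} \<in> faces \<T>" for i j k m
    using discrete_metric_triangle[OF that] by (intro ang_commute) (simp_all add: add.commute)
  have face: "w i * \<Delta> i j k + w j * \<Delta> j i k + w k * \<Delta> k i j \<le> 0"
    "w i * \<Delta> i j k + w j * \<Delta> j i k + w k * \<Delta> k i j = 0 \<Longrightarrow> E (w i) (w j) (w k)"
    if f: "convex hull {i, j, k} \<in> faces \<T>" for i j k
  proof -
    have edges: "edge j k \<in> edges \<T>" "edge i k \<in> edges \<T>" "edge i j \<in> edges \<T>"
      using edges_of_face[OF complex, of j k i] edges_of_face[OF complex, of i k j]
        edges_of_face[OF complex, of i j k] f by (simp_all add: insert_commute)
    have sym: "edge k i = edge i k" "edge k j = edge j k" "edge j i = edge i j"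
      by (simp_all add: insert_commute)
    note tri = discrete_metric_triangle[OF metric(1) f] discrete_metric_triangle[OF metric(2) f]
      and scales = scale[OF edges(1)] scale[OF edges(2)] scale[OF edges(3)]
    \<comment> \<open>Reorders the sides at each corner to the pattern \<open>ang b c a\<close>,
      \<open>ang a c b\<close>, \<open>ang a b c\<close> of the variation inequality.\<close>
    have \<Delta>: "\<Delta> i j k = ang (l' (edge i k)) (l' (edge i j)) (l' (edge j k))
      - ang (l (edge i k)) (l (edge i j)) (l (edge j k))"
      "\<Delta> j i k = ang (l' (edge j k)) (l' (edge i j)) (l' (edge i k))
      - ang (l (edge j k)) (l (edge i j)) (l (edge i k))"
      "\<Delta> k i j = ang (l' (edge j k)) (l' (edge i k)) (l' (edge i j))
      - ang (l (edge j k)) (l (edge i k)) (l (edge i j))"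
      using commute[OF metric(1), of i j k] commute[OF metric(2), of i j k]
        commute[OF metric(1), of j i k] commute[OF metric(2), of j i k]
        commute[OF metric(1), of k i j] commute[OF metric(2), of k i j] f
      unfolding \<Delta>_def sym by (simp_all add: insert_commute)
    show "w i * \<Delta> i j k + w j * \<Delta> j i k + w k * \<Delta> k i j \<le> 0"
      unfolding \<Delta> using tri scales by (rule variation)
    show "E (w i) (w j) (w k)" if "w i * \<Delta> i j k + w j * \<Delta> j i k + w k * \<Delta> k i j = 0"
      using tri scales that[unfolded \<Delta>] by (rule equality)
  qed
  have "w i * \<Delta> i j k + w j * \<Delta> j i k + w k * \<Delta> k i j = 0"
    unfolding \<Delta>_def
    using face_equality[OF complex curv commute[OF metric(1)] commute[OF metric(2)] _ f, where w = w]
      face(1) unfolding \<Delta>_def by blast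
  then show ?thesis
    using face(2)[OF f] by (simp add: w_def)
qed

theorem theorem1p2:
  fixes M :: "'m topology" and \<T> :: "'a::euclidean_space set set"
  assumes "closed_surface M" and "connected_space M" and "triangulates \<T> M"
  shows "(\<forall>l0 l l' :: 'a set \<Rightarrow> real. \<forall>u u' :: 'a \<Rightarrow> real.
            discrete_metric \<T> l0 \<and> discrete_metric \<T> l \<and> discrete_metric \<T> l' \<and>
            PL_conformal_factor \<T> l0 u l \<and> PL_conformal_factor \<T> l0 u' l' \<and>
            (\<forall>i \<in> vertices \<T>. PL_curvature \<T> l i = PL_curvature \<T> l' i) \<longrightarrow>
            (\<exists>t. \<forall>i \<in> vertices \<T>. u' i = u i + t)) \<and>
         (\<forall>l0 l l' :: 'a set \<Rightarrow> real. \<forall>u u' :: 'a \<Rightarrow> real.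
            discrete_metric \<T> l0 \<and> discrete_metric \<T> l \<and> discrete_metric \<T> l' \<and>
            PH_conformal_factor \<T> l0 u l \<and> PH_conformal_factor \<T> l0 u' l' \<and>
            (\<forall>i \<in> vertices \<T>. PH_curvature \<T> l i = PH_curvature \<T> l' i) \<longrightarrow>
            (\<forall>i \<in> vertices \<T>. u i = u' i))"
proof (intro conjI allI impI)
  have complex: "simplicial_complex \<T>" and cover: "\<forall>s\<in>\<T>. \<exists>f\<in>faces \<T>. s \<subseteq> f"
    and homeo: "top_of_set (\<Union>\<T>) homeomorphic_space M"
    using assms(3) by (auto simp: triangulates_def)
  have conn: "connected (\<Union>\<T>)"
    using homeomorphic_connected_space[OF homeo] assms(2)
    by (simp add: connectedin_def flip: connectedin_iff_connected)
  {
    fix l0 l l' :: "'a set \<Rightarrow> real" and u u' :: "'a \<Rightarrow> real"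
    assume h: "discrete_metric \<T> l0 \<and> discrete_metric \<T> l \<and> discrete_metric \<T> l' \<and>
            PL_conformal_factor \<T> l0 u l \<and> PL_conformal_factor \<T> l0 u' l' \<and>
            (\<forall>i \<in> vertices \<T>. PL_curvature \<T> l i = PL_curvature \<T> l' i)"
    \<comment> \<open>Recording only \<open>x = y\<close> in \<open>E\<close> suffices, since
      \<open>i\<close>, \<open>j\<close>, \<open>k\<close> range over all orderings of a face.
      Connectedness then makes the constants of different faces agree.\<close>
    have "u' i - u i = u' j - u j" if f: "convex hull {i, j, k} \<in> faces \<T>" for i j k
    proof (rule face_rigidity[where l = l and l' = l' and base = l0 and g = "\<lambda>a. a" and E = "\<lambda>x y z. x = y", OF complex _ _ _ _ _
          euclidean_angle_commute euclidean_angle_variation(1) _ f])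
      show "x = y" if "a < b + c" "b < a + c" "c < a + b" "a' < b' + c'" "b' < a' + c'" "c' < a' + b'"
        "a' = a * exp ((y + z) / 2)" "b' = b * exp ((x + z) / 2)" "c' = c * exp ((x + y) / 2)"
        "x * (euclidean_angle b' c' a' - euclidean_angle b c a) + y * (euclidean_angle a' c' b' - euclidean_angle a c b)
          + z * (euclidean_angle a' b' c' - euclidean_angle a b c) = 0" for a b c a' b' c' x y z
        using euclidean_angle_variation(2)[OF that] by simp
    qed (use h in \<open>auto simp: PL_conformal_factor_def\<close>)
    then obtain t where "\<forall>i\<in>vertices \<T>. u' i - u i = t"
      using constant_on_vertices[OF complex cover conn, of "\<lambda>i. u' i - u i"] by auto
    then show "\<exists>t. \<forall>i \<in> vertices \<T>. u' i = u i + t"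
      by (intro exI[of _ t]) (auto simp: algebra_simps)
  }
  fix l0 l l' :: "'a set \<Rightarrow> real" and u u' :: "'a \<Rightarrow> real"
  assume h: "discrete_metric \<T> l0 \<and> discrete_metric \<T> l \<and> discrete_metric \<T> l' \<and>
            PH_conformal_factor \<T> l0 u l \<and> PH_conformal_factor \<T> l0 u' l' \<and>
            (\<forall>i \<in> vertices \<T>. PH_curvature \<T> l i = PH_curvature \<T> l' i)"
  \<comment> \<open>Here the difference vanishes on each face separately, and every vertex lies in
    some face.\<close>
  have zero: "u' i - u i = 0 \<and> u' j - u j = 0 \<and> u' k - u k = 0"
    if f: "convex hull {i, j, k} \<in> faces \<T>" for i j k
    by (rule face_rigidity[where l = l and l' = l' and base = l0 and g = "\<lambda>a. sinh (a / 2)" and E = "\<lambda>x y z. x = 0 \<and> y = 0 \<and> z = 0",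
          OF complex _ _ _ _ _ hyperbolic_angle_commute hyperbolic_angle_variation f])
      (use h in \<open>auto simp: PH_conformal_factor_def\<close>)
  show "\<forall>i\<in>vertices \<T>. u i = u' i"
  proof
    fix v assume v: "v \<in> vertices \<T>"
    then obtain f where f: "f \<in> faces \<T>" "v \<in> f"
      using cover by (auto simp: vertices_def)
    from f(1) obtain i j k where ijk: "f = convex hull {i, j, k}"
      by (rule faceE)
    then have "v \<in> {i, j, k}"
      using f v vertices_of_face[OF complex] by blast
    then show "u v = u' v"
      using zero[of i j k] f ijk by auto
  qed
qed

end
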